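(* Let $K$ be a subfield of $\mathfrak{M}(\mathbb{C})$ which is finitely generated over $\mathbb{C}$ and has transcendence degree $\mathrm{Trans}_{\mathbb{C}}K = 1$. Then the following conditions are equivalent. (1) There exists a non-constant $f \in K$ with $f' \in K$. (2) $K$ is closed by derivative. (3) There exists a $\mathbb{C}$-linear isomorphism $\Phi : \mathbb{C} \to \mathbb{C}$ such that $\Phi^{*}K := \{ f \circ \Phi : f \in K \}$ is $\mathbb{C}(\zeta)$, or $\mathbb{C}(e^{\zeta})$, or a subfield of an elliptic function field which is closed by derivative.
   Context: $\mathfrak{M}(\mathbb{C})$ is the field of meromorphic functions on $\mathbb{C}$, and $\zeta$ is the coordinate of $\mathbb{C}$. A subfield $K$ that is finitely generated over $\mathbb{C}$ contains the constants $\mathbb{C}$; $\mathrm{Trans}_{\mathbb{C}}K$ is its transcendence degree over $\mathbb{C}$. A subfield $K$ of $\mathfrak{M}(\mathbb{C})$ is closed by derivative if $f' \in K$ for every $f \in K$. An elliptic function field is the field of all meromorphic functions on $\mathbb{C}$ that are periodic with respect to a fixed lattice of rank 2 in $\mathbb{C}$. Subfields are understood to contain $\mathbb{C}$. *)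

theory Defs
  imports
    "HOL-Complex_Analysis.Complex_Analysis"
    "HOL-Algebra.Generated_Fields"
    "HOL-Library.Extended_Nat"
    "HOL-Library.Multiset"
begin

section \<open>Finitely generated extensions and transcendence degree\<close>

definition fin_gen_field_over :: "('a, 'b) ring_scheme \<Rightarrow> 'a set \<Rightarrow> 'a set \<Rightarrow> bool" where
  "fin_gen_field_over R k K \<longleftrightarrow>
     (\<exists>H. finite H \<and> H \<subseteq> K \<and> K = generate_field R (k \<union> H))"

text \<open>A multiset over \<open>S\<close> encodes a monomial whose variables are indexed by the elements of
  \<open>S\<close>; \<open>eval_monom\<close> substitutes for each variable the element that indexes it.\<close>

definition eval_monom :: "('a, 'b) ring_scheme \<Rightarrow> 'a multiset \<Rightarrow> 'a" where
  "eval_monom R m = finprod R (\<lambda>x. x [^]\<^bsub>R\<^esub> count m x) (set_mset m)"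

text \<open>\<open>M\<close> and \<open>c\<close> are the monomials and coefficients of a polynomial over \<open>k\<close> in the
  variables \<open>S\<close>: only the zero polynomial may vanish at \<open>S\<close>.\<close>

definition alg_independent :: "('a, 'b) ring_scheme \<Rightarrow> 'a set \<Rightarrow> 'a set \<Rightarrow> bool" where
  "alg_independent R k S \<longleftrightarrow>
     S \<subseteq> carrier R \<and>
     (\<forall>M c. finite M \<longrightarrow> (\<forall>m\<in>M. set_mset m \<subseteq> S) \<longrightarrow> (\<forall>m\<in>M. c m \<in> k) \<longrightarrow>
        finsum R (\<lambda>m. c m \<otimes>\<^bsub>R\<^esub> eval_monom R m) M = \<zero>\<^bsub>R\<^esub> \<longrightarrow>
        (\<forall>m\<in>M. c m = \<zero>\<^bsub>R\<^esub>))"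

definition trans_degree :: "('a, 'b) ring_scheme \<Rightarrow> 'a set \<Rightarrow> 'a set \<Rightarrow> enat" where
  "trans_degree R k K =
     (SUP S \<in> {S. S \<subseteq> K \<and> finite S \<and> alg_independent R k S}. enat (card S))"


section \<open>The field of meromorphic functions on the complex plane\<close>

text \<open>A meromorphic function is represented by its unique total representative that is
  analytic away from its poles and takes the value 0 at each pole. Pointwise operations have to be
  followed by \<^const>\<open>remove_sings\<close>, which restores this normal form.\<close>

definition mero_field :: "(complex \<Rightarrow> complex) ring" where
  "mero_field =
     \<lparr>carrier = {f. f nicely_meromorphic_on UNIV},
      mult = (\<lambda>f g. remove_sings (\<lambda>z. f z * g z)),
      one = (\<lambda>_. 1),
      zero = (\<lambda>_. 0),
      add = (\<lambda>f g. remove_sings (\<lambda>z. f z + g z))\<rparr>"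

definition const_funs :: "(complex \<Rightarrow> complex) set" where
  "const_funs = range (\<lambda>c _. c)"

definition mero_deriv :: "(complex \<Rightarrow> complex) \<Rightarrow> complex \<Rightarrow> complex" where
  "mero_deriv f = remove_sings (deriv f)"

definition closed_by_derivative :: "(complex \<Rightarrow> complex) set \<Rightarrow> bool" where
  "closed_by_derivative K \<longleftrightarrow> (\<forall>f\<in>K. mero_deriv f \<in> K)"

definition rank2_lattice :: "complex set \<Rightarrow> bool" where
  "rank2_lattice \<Lambda> \<longleftrightarrow>
     (\<exists>\<omega>1 \<omega>2. \<omega>1 \<noteq> \<omega>2 \<and> independent {\<omega>1, \<omega>2} \<and>
        \<Lambda> = {of_int m * \<omega>1 + of_int n * \<omega>2 | m n. True})"

definition elliptic_field :: "complex set \<Rightarrow> (complex \<Rightarrow> complex) set" where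
  "elliptic_field \<Lambda> = {f \<in> carrier mero_field. \<forall>\<omega>\<in>\<Lambda>. \<forall>z. f (z + \<omega>) = f z}"

definition pullback :: "(complex \<Rightarrow> complex) \<Rightarrow> (complex \<Rightarrow> complex) set \<Rightarrow> (complex \<Rightarrow> complex) set" where
  "pullback \<Phi> K = {f \<circ> \<Phi> | f. f \<in> K}"


section \<open>Sanity checks\<close>

lemma carrier_mero: "f \<in> carrier mero_field \<longleftrightarrow> f nicely_meromorphic_on UNIV"
  by (simp add: mero_field_def)

lemma nicely_imp_mero: "f nicely_meromorphic_on UNIV \<Longrightarrow> f meromorphic_on UNIV"
  by (simp add: nicely_meromorphic_on_def)

lemma mero_eventually_remove_sings:
  assumes "f meromorphic_on UNIV"
  shows "eventually (\<lambda>w. remove_sings f w = f w) (at z)"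
proof (rule eventually_remove_sings_eq_at)
  show "isolated_singularity_at f z"
    using assms meromorphic_on_isolated_singularity meromorphic_on_subset by blast
qed

lemma remove_sings_nicely_id:
  assumes "f nicely_meromorphic_on UNIV"
  shows "remove_sings f = f"
proof
  fix z
  from assms have "is_pole f z \<and> f z = 0 \<or> f \<midarrow>z\<rightarrow> f z"
    by (auto simp: nicely_meromorphic_on_def)
  thus "remove_sings f z = f z"
    by auto
qed

lemma remove_sings_ext:
  assumes "\<And>z. eventually (\<lambda>w. f w = g w) (at z)"
  shows "remove_sings f = remove_sings g"
  by (rule ext, rule remove_sings_cong) (use assms in auto)

lemma remove_sings_closed:
  "f meromorphic_on UNIV \<Longrightarrow> remove_sings f nicely_meromorphic_on UNIV"
  by (rule remove_sings_nicely_meromorphic)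

lemma mero_inverse:
  assumes f: "f nicely_meromorphic_on UNIV" and nz: "f \<noteq> (\<lambda>_. 0)"
  shows "\<exists>g. g nicely_meromorphic_on UNIV \<and> remove_sings (\<lambda>z. g z * f z) = (\<lambda>_. 1)"
proof (intro exI conjI)
  let ?i = "\<lambda>z. inverse (f z)"
  have i: "?i meromorphic_on UNIV"
    using nicely_imp_mero[OF f] by (intro meromorphic_intros)
  show "remove_sings ?i nicely_meromorphic_on UNIV"
    by (rule remove_sings_closed[OF i])
  have ev: "eventually (\<lambda>w. f w \<noteq> 0) (at z)" for z
  proof -
    have "(\<forall>x\<in>UNIV. f x = 0) \<or> (\<forall>\<^sub>\<approx>x\<in>UNIV. f x \<noteq> 0)"
      using nicely_meromorphic_imp_constant_or_avoid[OF f, of 0] by (simp add: connected_UNIV)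
    with nz have "\<forall>\<^sub>\<approx>x\<in>UNIV. f x \<noteq> 0" by auto
    thus ?thesis by (auto simp: eventually_cosparse_open_eq)
  qed
  have "remove_sings (\<lambda>z. remove_sings ?i z * f z) = remove_sings (\<lambda>_. 1)"
  proof (rule remove_sings_ext)
    fix z
    show "eventually (\<lambda>w. remove_sings ?i w * f w = 1) (at z)"
      using ev[of z] mero_eventually_remove_sings[OF i, of z] by eventually_elim auto
  qed
  also have "\<dots> = (\<lambda>_. 1)"
    by (rule remove_sings_nicely_id) auto
  finally show "remove_sings (\<lambda>z. remove_sings ?i z * f z) = (\<lambda>_. 1)" .
qed

lemma field_mero_field: "field mero_field"
proof -
  let ?N = "\<lambda>f. f nicely_meromorphic_on UNIV"
  let ?m = "\<lambda>f g. remove_sings (\<lambda>z. f z * g z)"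
  let ?a = "\<lambda>f g. remove_sings (\<lambda>z. f z + g z)"
  have rid: "remove_sings (\<lambda>z. f z) = f" if "?N f" for f
    using remove_sings_nicely_id[OF that] by simp
  have red: "remove_sings (\<lambda>z. F (remove_sings h z) z) = remove_sings (\<lambda>z. F (h z) z)"
    if "h meromorphic_on UNIV" for F :: "complex \<Rightarrow> complex \<Rightarrow> complex" and h
  proof (rule remove_sings_ext)
    fix z show "eventually (\<lambda>w. F (remove_sings h w) w = F (h w) w) (at z)"
      using mero_eventually_remove_sings[OF that, of z] by eventually_elim simp
  qed
  have cl: "?N (?m f g)" "?N (?a f g)" if "?N f" "?N g" for f g
    using that by (auto intro!: remove_sings_closed meromorphic_on_mult meromorphic_on_add dest: nicely_imp_mero)
  have mm: "(\<lambda>z. f z * g z) meromorphic_on UNIV" "(\<lambda>z. f z + g z) meromorphic_on UNIV"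
    if "?N f" "?N g" for f g
    using that by (auto intro!: meromorphic_on_mult meromorphic_on_add dest: nicely_imp_mero)
  have ab: "abelian_group mero_field"
  proof (rule abelian_groupI, unfold mero_field_def, simp_all add: cl)
    fix f g h assume "?N f" "?N g" "?N h"
    show "?a (?a f g) h = ?a f (?a g h)"
      using red[of "\<lambda>z. f z + g z" "\<lambda>u z. u + h z"] red[of "\<lambda>z. g z + h z" "\<lambda>u z. f z + u"]
        mm \<open>?N f\<close> \<open>?N g\<close> \<open>?N h\<close> by (simp add: add.assoc)
  next
    fix f g show "?a f g = ?a g f" by (simp add: add.commute)
  next
    fix f assume "?N f" thus "remove_sings f = f" by (rule rid)
  next
    fix f assume f: "?N f"
    show "\<exists>g. ?N g \<and> ?a g f = (\<lambda>_. 0)"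
      using f by (intro exI[of _ "\<lambda>z. - f z"]) (auto simp: remove_sings_nicely_id)
  next
    show "(\<lambda>_. 0::complex) nicely_meromorphic_on UNIV" by auto
  qed
  have mo: "comm_monoid mero_field"
  proof (rule comm_monoidI, unfold mero_field_def, simp_all add: cl)
    fix f g h assume "?N f" "?N g" "?N h"
    show "?m (?m f g) h = ?m f (?m g h)"
      using red[of "\<lambda>z. f z * g z" "\<lambda>u z. u * h z"] red[of "\<lambda>z. g z * h z" "\<lambda>u z. f z * u"]
        mm \<open>?N f\<close> \<open>?N g\<close> \<open>?N h\<close> by (simp add: mult.assoc)
  next
    fix f g show "?m f g = ?m g f" by (simp add: mult.commute)
  next
    fix f assume "?N f" thus "remove_sings f = f" by (rule rid)
  next
    show "(\<lambda>_. 1::complex) nicely_meromorphic_on UNIV" by auto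
  qed
  have cr: "cring mero_field"
  proof (rule cringI[OF ab mo])
    fix f g h
    assume *: "f \<in> carrier mero_field" "g \<in> carrier mero_field" "h \<in> carrier mero_field"
    hence N: "?N f" "?N g" "?N h" by (auto simp: carrier_mero)
    have "?a (?m f h) (?m g h) = remove_sings (\<lambda>z. f z * h z + g z * h z)"
      using red[of "\<lambda>z. f z * h z" "\<lambda>u z. u + ?m g h z"]
        red[of "\<lambda>z. g z * h z" "\<lambda>u z. f z * h z + u"] mm N by simp
    moreover have "?m (?a f g) h = remove_sings (\<lambda>z. (f z + g z) * h z)"
      using red[of "\<lambda>z. f z + g z" "\<lambda>u z. u * h z"] mm N by simp
    ultimately have "?m (?a f g) h = ?a (?m f h) (?m g h)" by (simp add: algebra_simps)
    thus "(f \<oplus>\<^bsub>mero_field\<^esub> g) \<otimes>\<^bsub>mero_field\<^esub> h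
        = f \<otimes>\<^bsub>mero_field\<^esub> h \<oplus>\<^bsub>mero_field\<^esub> g \<otimes>\<^bsub>mero_field\<^esub> h"
      by (simp add: mero_field_def)
  qed
  show ?thesis
  proof (rule cring.cring_fieldI2[OF cr])
    show "\<zero>\<^bsub>mero_field\<^esub> \<noteq> \<one>\<^bsub>mero_field\<^esub>"
      by (simp add: mero_field_def fun_eq_iff)
    fix f assume "f \<in> carrier mero_field" "f \<noteq> \<zero>\<^bsub>mero_field\<^esub>"
    then obtain g where "?N g" "?m g f = (\<lambda>_. 1)"
      using mero_inverse[of f] by (auto simp: mero_field_def)
    thus "\<exists>g\<in>carrier mero_field. f \<otimes>\<^bsub>mero_field\<^esub> g = \<one>\<^bsub>mero_field\<^esub>"
      by (intro bexI[of _ g]) (auto simp: mero_field_def mult.commute)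
  qed
qed

lemma const_funs_subset: "const_funs \<subseteq> carrier mero_field"
  by (auto simp: const_funs_def carrier_mero)

lemma mero_deriv_closed:
  "f \<in> carrier mero_field \<Longrightarrow> mero_deriv f \<in> carrier mero_field"
  by (auto simp: carrier_mero mero_deriv_def
      intro!: remove_sings_closed meromorphic_on_deriv dest: nicely_imp_mero)

end

theory Submission
  imports Defs
begin

text \<open>If \<open>K\<close> is closed under the derivative, a non-constant \<open>f\<close> in \<open>K\<close> satisfies an autonomous
  equation \<open>Q(f, f') = 0\<close>. Hence for generic \<open>a\<close> there are only finitely many Taylor expansions of \<open>f\<close>
  at points where \<open>f = a\<close>, and two points with the same expansion differ by a period of \<open>f\<close>.
  If \<open>f\<close> has no period, or only periods on one real line, then \<open>f\<close> (respectively \<open>f\<close> as a function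
  of an exponential \<open>e\<close>) takes almost every value finitely often, so it is rational by the great
  Picard theorem. Every period of one non-constant element of \<open>K\<close> has a multiple that is a period of
  all of \<open>K\<close>, because algebraic equations over a field of periodic functions have finitely many roots;
  this leaves \<open>K\<close> inside \<open>\<complex>(\<zeta>)\<close>, inside \<open>\<complex>(e)\<close>, or inside an elliptic function field. In the first two
  cases the coefficients of the minimal polynomial of \<open>\<zeta>\<close> or \<open>e\<close> over \<open>K\<close> show that \<open>K\<close> contains \<open>\<zeta>\<close>
  or a power of \<open>e\<close>.\<close>

section \<open>Fields with a derivation\<close>

hide_const (open) up_ring.coeff up_ring.monom module.smult

text \<open>(1) gives (2) because the elements of \<open>K\<close> with derivative in
  \<open>K\<close> form a subfield containing the polynomials in \<open>f\<close>; all of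
  \<open>K\<close> is algebraic over it, and differentiating a minimal relation solves for the
  derivative. (3) gives (1) because each normal form contains a non-constant function together with
  its derivative, and a linear change of variable only multiplies derivatives by a constant. In the
  direction from (2) to (3), lying inside a rational function field does not yet identify
  \<open>K\<close>. Instead of classifying such subfields, the proof exploits that the generator
  solves \<open>D x = 1\<close> or \<open>D x = c * x\<close>. Two analytic obstacles shape the
  rest. Elements of \<open>K\<close> have poles, so Picard applies only after a Moebius
  transformation and needs three values with finite fibres instead of two. And a pole is represented
  by the value 0, so pointwise identities are claimed only at points of analyticity, and 0 is never
  a generic value. Finite generation turns the periods of single generators into one period of the
  whole field.\<close>

locale subfield_of =
  fixes K :: "'a::field_char_0 set"
  assumes one_in [simp, intro]: "1 \<in> K"
    and diff_in [simp, intro]: "a \<in> K \<Longrightarrow> b \<in> K \<Longrightarrow> a - b \<in> K"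
    and mult_in [simp, intro]: "a \<in> K \<Longrightarrow> b \<in> K \<Longrightarrow> a * b \<in> K"
    and inverse_in [simp, intro]: "a \<in> K \<Longrightarrow> inverse a \<in> K"
begin

lemma zero_in [simp, intro]: "0 \<in> K"
  using diff_in[OF one_in one_in] by simp

lemma uminus_in [simp, intro]: "a \<in> K \<Longrightarrow> - a \<in> K"
  using diff_in[of 0 a] by simp

lemma add_in [simp, intro]: "a \<in> K \<Longrightarrow> b \<in> K \<Longrightarrow> a + b \<in> K"
  using diff_in[of a "- b"] by simp

lemma divide_in [simp, intro]: "a \<in> K \<Longrightarrow> b \<in> K \<Longrightarrow> a / b \<in> K"
  by (simp add: divide_inverse)

lemma power_in [simp, intro]: "a \<in> K \<Longrightarrow> a ^ n \<in> K"
  by (induction n) auto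

lemma of_nat_in [simp, intro]: "of_nat n \<in> K"
  by (induction n) auto

lemma sum_in [intro]: "(\<And>i. i \<in> A \<Longrightarrow> h i \<in> K) \<Longrightarrow> sum h A \<in> K"
  by (induction A rule: infinite_finite_induct) auto

lemma poly_in: "(\<And>i. coeff p i \<in> K) \<Longrightarrow> x \<in> K \<Longrightarrow> poly p x \<in> K"
  unfolding poly_altdef by auto

end

definition algebraic_over :: "'a::field_char_0 set \<Rightarrow> 'a \<Rightarrow> bool" where
  "algebraic_over K x \<longleftrightarrow> (\<exists>p. p \<noteq> 0 \<and> (\<forall>i. coeff p i \<in> K) \<and> poly p x = 0)"

text \<open>Minimality is phrased as the vanishing of every relation of smaller degree, because the
  arguments below construct such relations and read off their coefficients, or conclude that a
  nonzero polynomial does not vanish at \<open>x\<close>.\<close>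

definition minimal_poly :: "'a::field_char_0 set \<Rightarrow> 'a \<Rightarrow> 'a poly \<Rightarrow> bool" where
  "minimal_poly K x p \<longleftrightarrow> lead_coeff p = 1 \<and> (\<forall>i. coeff p i \<in> K) \<and> poly p x = 0 \<and>
     (\<forall>q. (\<forall>i. coeff q i \<in> K) \<longrightarrow> poly q x = 0 \<longrightarrow> degree q < degree p \<longrightarrow> q = 0)"

lemma (in subfield_of) minimal_poly_exists:
  assumes "algebraic_over K x"
  obtains p where "minimal_poly K x p"
proof -
  let ?P = "\<lambda>p. p \<noteq> 0 \<and> (\<forall>i. coeff p i \<in> K) \<and> poly p x = 0"
  obtain p0 where "?P p0"
    using assms by (auto simp: algebraic_over_def)
  then obtain p where p: "?P p" and least: "\<And>q. ?P q \<Longrightarrow> degree p \<le> degree q"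
    using ex_has_least_nat[of ?P p0 degree] by auto
  have "minimal_poly K x (smult (inverse (lead_coeff p)) p)"
    unfolding minimal_poly_def using p least by (auto simp: not_less[symmetric])
  then show thesis
    by (rule that)
qed

lemma minimal_poly_degree_pos: "minimal_poly K x p \<Longrightarrow> degree p > 0"
  by (auto simp: minimal_poly_def elim!: degree_eq_zeroE intro!: Nat.gr0I)

locale derivation =
  fixes D :: "'a::field_char_0 \<Rightarrow> 'a"
  assumes add: "D (x + y) = D x + D y"
    and mult: "D (x * y) = D x * y + x * D y"
begin

lemma zero [simp]: "D 0 = 0"
  using add[of 0 0] by simp

lemma one [simp]: "D 1 = 0"
  using mult[of 1 1] by simp

lemma uminus: "D (- x) = - D x"
  using add[of x "- x"] by (simp add: eq_neg_iff_add_eq_0 add.commute)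

lemma diff: "D (x - y) = D x - D y"
  using add[of x "- y"] uminus[of y] by simp

lemma of_nat [simp]: "D (of_nat n) = 0"
  by (induction n) (auto simp: add)

lemma inverse: "D (inverse x) = - D x / x\<^sup>2"
proof (cases "x = 0")
  case False
  then have "D x * inverse x + x * D (inverse x) = 0"
    using mult[of x "inverse x"] by simp
  then show ?thesis
    using False by (simp add: field_simps power2_eq_square add_eq_0_iff)
qed simp

lemma power: "D (x ^ n) = of_nat n * x ^ (n - 1) * D x"
proof (induction n)
  case (Suc n)
  then show ?case
    by (cases n) (auto simp: mult algebra_simps)
qed simp

lemma poly: "D (poly p x) = poly (map_poly D p) x + poly (pderiv p) x * D x"
  by (induction p) (auto simp: add mult pderiv_pCons map_poly_pCons algebra_simps)

lemma coeff_map_poly_D: "coeff (map_poly D p) i = D (coeff p i)"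
  by (simp add: coeff_map_poly)

end

locale differential_subfield = subfield_of K + derivation D
  for K :: "'a::field_char_0 set" and D :: "'a \<Rightarrow> 'a"

sublocale differential_subfield \<subseteq> closed_part: subfield_of "{a \<in> K. D a \<in> K}"
  by unfold_locales (auto simp: diff mult inverse)

context differential_subfield
begin

text \<open>Differentiating the minimal relation gives a linear equation for \<open>D x\<close>. Its
  leading factor \<open>poly (pderiv p) x\<close> is nonzero by minimality and characteristic zero,
  and all other terms lie in \<open>K\<close>.\<close>

lemma D_in_if_algebraic:
  assumes "x \<in> K" "algebraic_over {a \<in> K. D a \<in> K} x"
  shows "D x \<in> K"
proof -
  obtain p where p: "minimal_poly {a \<in> K. D a \<in> K} x p"
    using closed_part.minimal_poly_exists assms(2) by blast
  note pos = minimal_poly_degree_pos[OF p]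
  have coeffs: "coeff p i \<in> K" "D (coeff p i) \<in> K" for i
    using p by (auto simp: minimal_poly_def)
  have "coeff (pderiv p) i \<in> {a \<in> K. D a \<in> K}" for i
    using coeffs[of "Suc i"] closed_part.mult_in[OF closed_part.of_nat_in, of "coeff p (Suc i)" "Suc i"]
    by (simp add: coeff_pderiv)
  moreover have "pderiv p \<noteq> 0" "degree (pderiv p) < degree p"
    using pos by (auto simp: pderiv_eq_0_iff degree_pderiv)
  ultimately have nz: "poly (pderiv p) x \<noteq> 0"
    using p by (auto simp: minimal_poly_def)
  have "0 = D (poly p x)"
    using p by (simp add: minimal_poly_def)
  then have "D x = - poly (map_poly D p) x / poly (pderiv p) x"
    using nz by (simp add: poly field_simps add_eq_0_iff)
  also have "\<dots> \<in> K"
    using assms(1) coeffs by (intro divide_in uminus_in poly_in) (auto simp: coeff_map_poly_D coeff_pderiv)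
  finally show ?thesis .
qed

end

locale differential_field_with_constants = differential_subfield K D
  for K :: "'a::field_char_0 set" and D :: "'a \<Rightarrow> 'a" +
  assumes D_in: "a \<in> K \<Longrightarrow> D a \<in> K"
    and constants_in: "D a = 0 \<Longrightarrow> a \<in> K"
begin

text \<open>Differentiating the relation given by the minimal polynomial and, in the exponential case,
  subtracting a multiple of that relation leaves a polynomial relation of smaller degree, so all its
  coefficients vanish.\<close>

lemma primitive_in:
  assumes "D x = 1" "algebraic_over K x"
  shows "x \<in> K"
proof -
  obtain p where p: "minimal_poly K x p"
    using minimal_poly_exists assms(2) by blast
  obtain n where n: "degree p = Suc n"
    using minimal_poly_degree_pos[OF p] by (cases "degree p") auto
  have lead: "coeff p (Suc n) = 1" and coeffs: "coeff p i \<in> K" for i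
    using p n by (auto simp: minimal_poly_def)
  define r where "r = map_poly D p + pderiv p"
  have "poly r x = D (poly p x)"
    by (simp add: r_def poly assms)
  then have "poly r x = 0"
    using p by (simp add: minimal_poly_def)
  moreover have "coeff r i \<in> K" for i
    using coeffs D_in by (simp add: r_def coeff_map_poly_D coeff_pderiv del: of_nat_Suc)
  moreover have "degree r < degree p"
    using n lead coeff_eq_0[of p]
    by (intro degree_lessI) (auto simp: r_def coeff_map_poly_D coeff_pderiv Suc_le_eq le_less)
  ultimately have "r = 0"
    using p by (auto simp: minimal_poly_def)
  \<comment> \<open>Because \<open>p\<close> is monic, this coefficient is the derivative of
    \<open>coeff p n + of_nat (Suc n) * x\<close>. That sum is therefore a constant, and solving for
    \<open>x\<close> finishes the proof.\<close>
  then have "coeff r n = 0"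
    by simp
  then have "D (coeff p n + of_nat (Suc n) * x) = 0"
    using lead assms(1) by (simp add: r_def coeff_map_poly_D coeff_pderiv add mult del: of_nat_Suc)
  then have "coeff p n + of_nat (Suc n) * x - coeff p n \<in> K"
    using constants_in coeffs by (intro diff_in) auto
  then have "of_nat (Suc n) * x / of_nat (Suc n) \<in> K"
    by (intro divide_in) (auto simp del: of_nat_Suc)
  then show ?thesis
    by (simp del: of_nat_Suc)
qed

lemma exponential_power_in:
  assumes "D x = c * x" "D c = 0" "x \<noteq> 0" "algebraic_over K x"
  obtains n where "n > 0" "x ^ n \<in> K"
    "\<And>q. (\<And>i. coeff q i \<in> K) \<Longrightarrow> poly q x = 0 \<Longrightarrow> degree q < n \<Longrightarrow> q = 0"
proof -
  obtain p where p: "minimal_poly K x p"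
    using minimal_poly_exists assms(4) by blast
  define n where "n = degree p"
  have pos: "n > 0"
    using minimal_poly_degree_pos[OF p] by (simp add: n_def)
  have lead: "coeff p n = 1" and coeffs: "coeff p i \<in> K" and c: "c \<in> K" for i
    using p assms(2) constants_in by (auto simp: minimal_poly_def n_def)
  \<comment> \<open>Since \<open>D (x ^ i) = of_nat i * c * x ^ i\<close>, differentiation
    multiplies the top monomial by \<open>of_nat n * c\<close>; subtracting that multiple of
    \<open>p\<close> removes it.\<close>
  define r where "r = map_poly D p + smult c (pCons 0 (pderiv p)) - smult (of_nat n * c) p"
  have coeff_r: "coeff r i = D (coeff p i) + of_nat i * c * coeff p i - of_nat n * c * coeff p i" for i
    by (cases i) (auto simp: r_def coeff_map_poly_D coeff_pderiv algebra_simps)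
  have "poly r x = D (poly p x) - of_nat n * c * poly p x"
    by (simp add: r_def poly assms)
  then have "poly r x = 0"
    using p by (simp add: minimal_poly_def)
  moreover have "coeff r i \<in> K" for i
    unfolding coeff_r using coeffs D_in c by auto
  moreover have "degree r < degree p"
    using pos lead coeff_eq_0[of p]
    by (intro degree_lessI) (auto simp: coeff_r le_less n_def)
  ultimately have "r = 0"
    using p by (auto simp: minimal_poly_def)
  then have a0: "D (coeff p 0) = of_nat n * c * coeff p 0"
    using coeff_r[of 0] by simp
  \<comment> \<open>Otherwise the relation could be divided by \<open>x\<close>.\<close>
  have nz: "coeff p 0 \<noteq> 0"
  proof
    assume 0: "coeff p 0 = 0"
    then obtain q where q: "p = pCons 0 q"
      by (cases p) auto
    have "q \<noteq> 0" "degree q < degree p"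
      using q pos by (auto simp: n_def)
    moreover have "coeff q i \<in> K" for i
      using coeffs[of "Suc i"] q by simp
    moreover have "poly q x = 0"
      using p q assms(3) by (simp add: minimal_poly_def)
    ultimately show False
      using p by (auto simp: minimal_poly_def)
  qed
  obtain m where m: "n = Suc m"
    using pos by (cases n) auto
  \<comment> \<open>The constant term of \<open>p\<close> and \<open>x ^ n\<close> solve the same
    equation \<open>D y = of_nat n * c * y\<close>, so their quotient has derivative 0.\<close>
  define y where "y = x ^ n"
  have "D y = of_nat n * c * (x ^ (n - 1) * x)"
    by (simp add: y_def power assms(1) algebra_simps)
  also have "x ^ (n - 1) * x = y"
    using m by (simp add: y_def)
  finally have "D y = of_nat n * c * y" .
  moreover have "y \<noteq> 0"
    using assms(3) by (simp add: y_def)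
  ultimately have "D (coeff p 0 * inverse (x ^ n)) = 0"
    unfolding y_def[symmetric] by (simp only: mult inverse a0) (simp add: field_simps power2_eq_square)
  then have "coeff p 0 * inverse (x ^ n) \<in> K"
    by (rule constants_in)
  then have "coeff p 0 / (coeff p 0 * inverse (x ^ n)) \<in> K"
    by (intro divide_in coeffs)
  moreover have "coeff p 0 / (coeff p 0 * inverse (x ^ n)) = x ^ n"
    using nz assms(3) by (simp add: field_simps)
  ultimately have "x ^ n \<in> K"
    by simp
  \<comment> \<open>Minimality of \<open>p\<close> means that the powers of \<open>x\<close> below
    \<open>n\<close> are linearly independent over \<open>K\<close>;
    \<open>rational_in_power\<close> compares coefficients with it.\<close>
  with pos show thesis
    by (rule that) (use p in \<open>auto simp: minimal_poly_def n_def\<close>)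
qed

end

text \<open>The coefficients at exponents congruent to \<open>r\<close> modulo \<open>n\<close>, for
  \<open>r < n\<close>. Splitting by residues lets a rational function of \<open>x\<close> be
  compared with rational functions of \<open>x ^ n\<close>.\<close>

definition poly_section :: "nat \<Rightarrow> nat \<Rightarrow> 'a::zero poly \<Rightarrow> 'a poly" where
  "poly_section n r p = Abs_poly (\<lambda>j. coeff p (r + n * j))"

lemma coeff_poly_section:
  assumes "n > 0"
  shows "coeff (poly_section n r p) j = coeff p (r + n * j)"
proof -
  have "coeff p (r + n * j) = 0" if "j > degree p" for j
  proof (rule coeff_eq_0)
    have "j \<le> n * j"
      using assms by simp
    with that show "degree p < r + n * j"
      by linarith
  qed
  then show ?thesis
    unfolding poly_section_def by (subst coeff_Abs_poly[of "degree p"]) auto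
qed

lemma poly_eq_sum_sections:
  fixes p :: "'a::comm_ring_1 poly"
  assumes "n > 0"
  shows "poly p x = (\<Sum>r<n. poly (poly_section n r p) (x ^ n) * x ^ r)"
proof -
  \<comment> \<open>\<open>N\<close> blocks of length \<open>n\<close> cover every exponent up to
    the degree, and each index below \<open>n * N\<close> is uniquely \<open>r + n * j\<close>; the
    surplus coefficients are 0.\<close>
  define N where "N = Suc (degree p)"
  have "poly p x = (\<Sum>i<n * N. coeff p i * x ^ i)"
  proof -
    have "N \<le> n * N"
      using assms by simp
    then show ?thesis
      unfolding poly_altdef N_def
      by (intro sum.mono_neutral_left) (auto intro: le_degree)
  qed
  also have "\<dots> = (\<Sum>(j, r)\<in>{..<N} \<times> {..<n}. coeff p (r + n * j) * x ^ (r + n * j))"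
  proof (rule sum.reindex_bij_witness[of _ "\<lambda>(j, r). r + n * j" "\<lambda>i. (i div n, i mod n)"])
    fix i assume "i \<in> {..<n * N}"
    then show "(i div n, i mod n) \<in> {..<N} \<times> {..<n}"
      using assms by (auto simp: less_mult_imp_div_less mult.commute)
  next
    fix a assume "a \<in> {..<N} \<times> {..<n}"
    then obtain j r where a: "a = (j, r)" "j < N" "r < n"
      by auto
    then have "n * Suc j \<le> n * N"
      by (intro mult_le_mono2) auto
    with a show "(case a of (j, r) \<Rightarrow> r + n * j) \<in> {..<n * N}"
      by auto
  qed (use assms in auto)
  also have "\<dots> = (\<Sum>r<n. (\<Sum>j<N. coeff p (r + n * j) * (x ^ n) ^ j) * x ^ r)"
    by (subst sum.cartesian_product[symmetric], subst sum.swap)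
      (simp add: sum_distrib_right power_add power_mult, simp add: mult_ac)
  also have "\<dots> = (\<Sum>r<n. poly (poly_section n r p) (x ^ n) * x ^ r)"
  proof (intro sum.cong refl arg_cong2[of _ _ _ _ "(*)"])
    fix r
    have deg: "degree (poly_section n r p) < N"
      unfolding N_def
    proof (rule degree_lessI)
      show "\<forall>k\<ge>Suc (degree p). coeff (poly_section n r p) k = 0"
      proof (intro allI impI)
        fix k assume "k \<ge> Suc (degree p)"
        moreover have "k \<le> n * k"
          using assms by simp
        ultimately have "degree p < r + n * k"
          by linarith
        then show "coeff (poly_section n r p) k = 0"
          by (simp add: coeff_poly_section assms coeff_eq_0)
      qed
    qed auto
    have "poly (poly_section n r p) y = (\<Sum>j<N. coeff (poly_section n r p) j * y ^ j)" for y
      unfolding poly_altdef using deg by (intro sum.mono_neutral_left) (auto intro: le_degree)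
    then show "(\<Sum>j<N. coeff p (r + n * j) * (x ^ n) ^ j) = poly (poly_section n r p) (x ^ n)"
      by (simp add: coeff_poly_section assms)
  qed
  finally show ?thesis .
qed

section \<open>Meromorphic functions as a differential field\<close>

text \<open>As a type, the record \<open>mero_field\<close> becomes an instance of the class of
  fields, so that polynomials and the finiteness of their roots are available; \<open>mfun\<close>
  leads back to functions.\<close>

typedef mero = "carrier mero_field"
  morphisms mfun Mero
  using const_funs_subset by (auto simp: const_funs_def)

interpretation MF: cring mero_field
  using field_mero_field by (simp add: field_def domain_def)

lemma mfun_carrier [simp, intro]: "mfun x \<in> carrier mero_field"
  by (rule mfun)

instantiation mero :: field
begin

definition zero_mero :: mero where "0 = Mero \<zero>\<^bsub>mero_field\<^esub>"
definition one_mero :: mero where "1 = Mero \<one>\<^bsub>mero_field\<^esub>"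
definition plus_mero :: "mero \<Rightarrow> mero \<Rightarrow> mero" where
  "x + y = Mero (mfun x \<oplus>\<^bsub>mero_field\<^esub> mfun y)"
definition times_mero :: "mero \<Rightarrow> mero \<Rightarrow> mero" where
  "x * y = Mero (mfun x \<otimes>\<^bsub>mero_field\<^esub> mfun y)"
definition uminus_mero :: "mero \<Rightarrow> mero" where
  "- x = Mero (\<ominus>\<^bsub>mero_field\<^esub> mfun x)"
definition minus_mero :: "mero \<Rightarrow> mero \<Rightarrow> mero" where
  "x - y = x + - (y :: mero)"
definition inverse_mero :: "mero \<Rightarrow> mero" where
  "inverse x = (if x = 0 then 0 else Mero (inv\<^bsub>mero_field\<^esub> mfun x))"
definition divide_mero :: "mero \<Rightarrow> mero \<Rightarrow> mero" where
  "x div y = x * inverse (y :: mero)"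

instance
proof
  note defs = zero_mero_def one_mero_def plus_mero_def times_mero_def uminus_mero_def
    minus_mero_def Mero_inverse Mero_inject mfun_inverse
  fix a b c :: mero
  show "a + b + c = a + (b + c)"
    by (simp add: defs MF.add.m_assoc)
  show "a + b = b + a"
    by (simp add: defs MF.add.m_comm)
  show "0 + a = a" "- a + a = 0" "a - b = a + - b"
    by (simp_all add: defs MF.l_neg)
  show "a * b * c = a * (b * c)"
    by (simp add: defs MF.m_assoc)
  show "a * b = b * a"
    by (simp add: defs MF.m_comm)
  show "1 * a = a"
    by (simp add: defs)
  show "(a + b) * c = a * c + b * c"
    by (simp add: defs MF.l_distr)
  show "(0::mero) \<noteq> 1"
    using Mero_inject[OF MF.zero_closed MF.one_closed]
    by (simp add: zero_mero_def one_mero_def) (simp add: mero_field_def fun_eq_iff)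
  show "a div b = a * inverse b"
    by (simp add: divide_mero_def)
  show "inverse (0::mero) = 0"
    by (simp add: inverse_mero_def)
  assume "a \<noteq> 0"
  then have "mfun a \<noteq> \<zero>\<^bsub>mero_field\<^esub>"
    by (metis mfun_inverse zero_mero_def)
  then have "mfun a \<in> Units mero_field"
    by (simp add: field.field_Units[OF field_mero_field])
  then show "inverse a * a = 1"
    using \<open>a \<noteq> 0\<close> by (simp add: inverse_mero_def times_mero_def one_mero_def Mero_inverse MF.Units_l_inv)
qed

end

lemma mfun_ring:
  "mfun 0 = \<zero>\<^bsub>mero_field\<^esub>" "mfun 1 = \<one>\<^bsub>mero_field\<^esub>"
  "mfun (x + y) = mfun x \<oplus>\<^bsub>mero_field\<^esub> mfun y"
  "mfun (x * y) = mfun x \<otimes>\<^bsub>mero_field\<^esub> mfun y"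
  "mfun (- x) = \<ominus>\<^bsub>mero_field\<^esub> mfun x"
  by (simp_all add: zero_mero_def one_mero_def plus_mero_def times_mero_def uminus_mero_def Mero_inverse)

lemma mfun_inv: "x \<noteq> 0 \<Longrightarrow> mfun (inverse x) = inv\<^bsub>mero_field\<^esub> mfun x"
proof -
  assume "x \<noteq> 0"
  then have "mfun x \<in> Units mero_field"
    by (metis field.field_Units[OF field_mero_field] mfun_inverse zero_mero_def DiffI mfun_carrier singletonD)
  then show ?thesis
    using \<open>x \<noteq> 0\<close> by (simp add: inverse_mero_def Mero_inverse)
qed

lemma mfun_nicely [simp, intro]: "mfun x nicely_meromorphic_on UNIV"
  using mfun_carrier[of x] by (simp add: carrier_mero)

lemma mfun_meromorphic [simp, intro]: "mfun x meromorphic_on UNIV" "mfun x meromorphic_on {z}"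
  using mfun_nicely[of x] nicely_imp_mero meromorphic_on_subset by blast+

lemma mfun_0 [simp]: "mfun 0 = (\<lambda>_. 0)" and mfun_1 [simp]: "mfun 1 = (\<lambda>_. 1)"
  by (simp_all add: mfun_ring mero_field_def)

lemma mfun_Mero: "f nicely_meromorphic_on UNIV \<Longrightarrow> mfun (Mero f) = f"
  by (simp add: Mero_inverse carrier_mero)

text \<open>The normal form puts 0 at each pole, so there the value of a sum or product need not be
  the sum or product of the values. \<open>reg\<close> marks the points where evaluation respects
  the operations; the exceptions are isolated.\<close>

definition reg :: "mero \<Rightarrow> complex \<Rightarrow> bool" where
  "reg x z \<longleftrightarrow> mfun x analytic_on {z}"

lemma eventually_reg: "eventually (reg x) (at z)"
  using meromorphic_on_imp_analytic_cosparse[OF mfun_meromorphic(1), of x]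
  by (simp add: reg_def[abs_def] eventually_cosparse_open_eq)

text \<open>A pole has the value 0 in the normal form, so any other value certifies analyticity.
  Fibres over nonzero values can thus be treated without mentioning poles.\<close>

lemma reg_if_nonzero: "mfun x z \<noteq> 0 \<Longrightarrow> reg x z"
  unfolding reg_def
  by (metis UNIV_I mfun_nicely nicely_meromorphic_on_def meromorphic_at_isCont_imp_analytic isCont_def mfun_meromorphic(2))

text \<open>Removing singularities depends only on a punctured neighbourhood, so agreement with an
  analytic \<open>h\<close> near \<open>z\<close> extends to \<open>z\<close> itself.\<close>

lemma mfun_eqI:
  assumes "eventually (\<lambda>w. mfun x w = h w) (at z)" "h analytic_on {z}"
  shows "reg x z" "mfun x z = h z"
proof -
  have "mfun x z = remove_sings (mfun x) z"
    by (simp add: remove_sings_nicely_id)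
  also have "\<dots> = remove_sings h z"
    using assms by (intro remove_sings_cong) auto
  also have "\<dots> = h z"
    using assms by simp
  finally show eq: "mfun x z = h z" .
  have "eventually (\<lambda>w. mfun x w = h w) (nhds z)"
    using assms(1) eq by (simp add: eventually_nhds_conv_at)
  then have "mfun x analytic_on {z} \<longleftrightarrow> h analytic_on {z}"
    by (rule analytic_at_cong) auto
  then show "reg x z"
    using assms by (simp add: reg_def)
qed

lemma eventually_mfun_add: "eventually (\<lambda>w. mfun (x + y) w = mfun x w + mfun y w) (at z)"
  and eventually_mfun_mult: "eventually (\<lambda>w. mfun (x * y) w = mfun x w * mfun y w) (at z)"
  unfolding mfun_ring
  by (simp_all add: mero_field_def, (intro mero_eventually_remove_sings meromorphic_intros mfun_meromorphic)+)

lemma reg_add [simp, intro]: "reg x z \<Longrightarrow> reg y z \<Longrightarrow> reg (x + y) z"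
  and mfun_add [simp]: "reg x z \<Longrightarrow> reg y z \<Longrightarrow> mfun (x + y) z = mfun x z + mfun y z"
  using mfun_eqI[OF eventually_mfun_add[of x y z]] analytic_on_add[of "mfun x" "{z}" "mfun y"]
  by (auto simp: reg_def)

lemma reg_mult [simp, intro]: "reg x z \<Longrightarrow> reg y z \<Longrightarrow> reg (x * y) z"
  and mfun_mult [simp]: "reg x z \<Longrightarrow> reg y z \<Longrightarrow> mfun (x * y) z = mfun x z * mfun y z"
  using mfun_eqI[OF eventually_mfun_mult[of x y z]] analytic_on_mult[of "mfun x" "{z}" "mfun y"]
  by (auto simp: reg_def)

lemma reg_0 [simp]: "reg 0 z" and reg_1 [simp]: "reg 1 z"
  by (simp_all add: reg_def)

text \<open>The identity theorem. Zeros have to accumulate at a single point only, which need not be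
  known to be regular.\<close>

lemma mero_eq_0I:
  assumes "frequently (\<lambda>w. mfun x w = 0) (at z)"
  shows "x = 0"
proof -
  have "mfun x = mfun 0"
    using frequently_eq_meromorphic_imp_constant[OF assms mfun_nicely] by auto
  then show ?thesis
    by (simp only: mfun_inject)
qed

definition cst :: "complex \<Rightarrow> mero" where "cst c = Mero (\<lambda>_. c)"

lemma mfun_cst [simp]: "mfun (cst c) = (\<lambda>_. c)"
  by (simp add: cst_def mfun_Mero nicely_meromorphic_on_const)

lemma reg_cst [simp]: "reg (cst c) z"
  by (simp add: reg_def)

lemma mfun_uminus [simp]: "mfun (- x) = (\<lambda>z. - mfun x z)"
proof -
  let ?y = "Mero (\<lambda>z. - mfun x z)"
  have y: "mfun ?y = (\<lambda>z. - mfun x z)"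
    by (rule mfun_Mero) auto
  have "eventually (\<lambda>w. mfun (x + ?y) w = 0) (at 0)"
    using eventually_mfun_add[of x ?y 0] by eventually_elim (simp add: y)
  then have "x + ?y = 0"
    by (intro mero_eq_0I) (auto intro: eventually_frequently)
  then show ?thesis
    by (metis y minus_unique)
qed

lemma reg_uminus [simp]: "reg (- x) z \<longleftrightarrow> reg x z"
  using analytic_on_neg[of "mfun x" "{z}"] analytic_on_neg[of "\<lambda>z. - mfun x z" "{z}"]
  by (auto simp: reg_def)

lemma reg_diff [simp, intro]: "reg x z \<Longrightarrow> reg y z \<Longrightarrow> reg (x - y) z"
  and mfun_diff [simp]: "reg x z \<Longrightarrow> reg y z \<Longrightarrow> mfun (x - y) z = mfun x z - mfun y z"
  using reg_add[of x z "-y"] mfun_add[of x z "-y"] by simp_all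

lemma mero_eqI:
  assumes "frequently (\<lambda>w. reg x w \<and> reg y w \<longrightarrow> mfun x w = mfun y w) (at z)"
  shows "x = y"
proof -
  have "eventually (\<lambda>w. reg x w \<and> reg y w) (at z)"
    using eventually_reg[of x z] eventually_reg[of y z] by eventually_elim auto
  from frequently_eventually_frequently[OF assms this]
  have "frequently (\<lambda>w. mfun (x - y) w = 0) (at z)"
    by (rule frequently_elim1) auto
  then show ?thesis
    using mero_eq_0I by fastforce
qed

lemma mero_eqI':
  assumes "\<And>w. reg x w \<Longrightarrow> reg y w \<Longrightarrow> mfun x w = mfun y w"
  shows "x = y"
  by (rule mero_eqI[of _ _ 0]) (use assms in \<open>auto intro!: eventually_frequently\<close>)

lemma reg_inverse [simp, intro]: "mfun x z \<noteq> 0 \<Longrightarrow> reg (inverse x) z"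
  and mfun_inverse_at [simp]: "mfun x z \<noteq> 0 \<Longrightarrow> mfun (inverse x) z = inverse (mfun x z)"
proof -
  assume nz: "mfun x z \<noteq> 0"
  then have r: "reg x z"
    by (rule reg_if_nonzero)
  have x: "x \<noteq> 0"
    using nz by auto
  have ev: "eventually (\<lambda>w. mfun (inverse x) w = inverse (mfun x w)) (at z)"
    using eventually_mfun_mult[of x "inverse x" z]
    by eventually_elim (use x in \<open>auto simp: field_simps inverse_eq_divide\<close>, metis mult_zero_left zero_neq_one nonzero_eq_divide_eq mult.commute)
  have an: "(\<lambda>w. inverse (mfun x w)) analytic_on {z}"
    using r nz by (intro analytic_on_inverse) (auto simp: reg_def)
  show "reg (inverse x) z" "mfun (inverse x) z = inverse (mfun x z)"
    using mfun_eqI[OF ev an] by auto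
qed

lemma cst_hom [simp]: "cst 0 = 0" "cst 1 = 1" "cst (a + b) = cst a + cst b" "cst (a * b) = cst a * cst b"
    "cst (- a) = - cst a" "cst (a - b) = cst a - cst b"
  by (rule mero_eqI', simp)+

lemma cst_inject [simp]: "cst a = cst b \<longleftrightarrow> a = b"
  by (metis mfun_cst)

lemma cst_eq_0_iff [simp]: "cst a = 0 \<longleftrightarrow> a = 0"
  by (metis cst_inject cst_hom(1))

lemma cst_of_nat: "cst (of_nat n) = of_nat n"
  by (induction n) auto

instance mero :: field_char_0
proof
  show "inj (of_nat :: nat \<Rightarrow> mero)"
    by (rule injI) (metis cst_of_nat cst_inject of_nat_eq_iff)
qed

section \<open>The derivation on meromorphic functions and its constants\<close>

definition D :: "mero \<Rightarrow> mero" where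
  "D x = Mero (mero_deriv (mfun x))"

lemma mfun_D: "mfun (D x) = mero_deriv (mfun x)"
  by (simp add: D_def Mero_inverse mero_deriv_closed)

lemma reg_D [simp]: "reg x z \<Longrightarrow> reg (D x) z"
  and mfun_D_reg: "reg x z \<Longrightarrow> mfun (D x) z = deriv (mfun x) z"
proof -
  assume r: "reg x z"
  then have *: "deriv (mfun x) analytic_on {z}"
    by (auto simp: reg_def intro: analytic_deriv)
  then show "mfun (D x) z = deriv (mfun x) z"
    by (simp add: mfun_D mero_deriv_def)
  show "reg (D x) z"
    using * unfolding reg_def mfun_D mero_deriv_def by (rule remove_sings_analytic_on)
qed

lemma reg_deriv: "reg x z \<Longrightarrow> (mfun x has_field_derivative mfun (D x) z) (at z)"
  using analytic_on_imp_differentiable_at[of "mfun x" "{z}" z]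
  by (simp add: mfun_D_reg reg_def field_differentiable_derivI)

lemma eventually_reg_nhds: "reg x z \<Longrightarrow> eventually (reg x) (nhds z)"
  using eventually_reg[of x z] by (simp add: eventually_nhds_conv_at)

text \<open>\<open>P\<close> may exclude isolated points, such as poles of the constituents, because
  meromorphic functions that agree off such points are equal.\<close>

lemma D_eqI:
  assumes "\<And>w. reg x w \<Longrightarrow> reg y w \<Longrightarrow> P w \<Longrightarrow> (mfun x has_field_derivative mfun y w) (at w)"
    and "\<And>z. eventually P (at z)"
  shows "D x = y"
proof (rule mero_eqI[of _ _ 0])
  have "eventually (\<lambda>w. reg x w \<and> reg y w \<and> P w) (at 0)"
    using eventually_reg[of x 0] eventually_reg[of y 0] assms(2)[of 0] by eventually_elim auto
  then have "eventually (\<lambda>w. mfun (D x) w = mfun y w) (at 0)"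
    by eventually_elim (use assms(1) in \<open>auto simp: mfun_D_reg DERIV_imp_deriv\<close>)
  then show "frequently (\<lambda>w. reg (D x) w \<and> reg y w \<longrightarrow> mfun (D x) w = mfun y w) (at 0)"
    by (intro eventually_frequently) (auto elim: eventually_mono)
qed

lemma D_add [simp]: "D (x + y) = D x + D y"
proof (rule D_eqI[where P = "\<lambda>w. reg x w \<and> reg y w"])
  fix z show "eventually (\<lambda>w. reg x w \<and> reg y w) (at z)"
    using eventually_reg[of x z] eventually_reg[of y z] by eventually_elim auto
next
  fix w assume r: "reg x w \<and> reg y w"
  have ev: "eventually (\<lambda>v. mfun (x + y) v = mfun x v + mfun y v) (nhds w)"
    using eventually_reg_nhds[of x w] eventually_reg_nhds[of y w] r
    by (auto elim: eventually_elim2)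
  show "(mfun (x + y) has_field_derivative mfun (D x + D y) w) (at w)"
    by (subst DERIV_cong_ev[OF refl ev refl]) (use r in \<open>auto intro!: derivative_eq_intros reg_deriv\<close>)
qed

lemma D_mult: "D (x * y) = D x * y + x * D y"
proof (rule D_eqI[where P = "\<lambda>w. reg x w \<and> reg y w"])
  fix z show "eventually (\<lambda>w. reg x w \<and> reg y w) (at z)"
    using eventually_reg[of x z] eventually_reg[of y z] by eventually_elim auto
next
  fix w assume r: "reg x w \<and> reg y w"
  have ev: "eventually (\<lambda>v. mfun (x * y) v = mfun x v * mfun y v) (nhds w)"
    using eventually_reg_nhds[of x w] eventually_reg_nhds[of y w] r
    by (auto elim: eventually_elim2)
  show "(mfun (x * y) has_field_derivative mfun (D x * y + x * D y) w) (at w)"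
    by (subst DERIV_cong_ev[OF refl ev refl])
      (use r in \<open>auto intro!: derivative_eq_intros reg_deriv\<close>)
qed

lemma D_cst [simp]: "D (cst c) = 0"
  by (rule D_eqI[where P = "\<lambda>_. True"]) auto

text \<open>The vanishing derivative is integrated on one small disc only. The identity theorem
  spreads the constant, so the position of the poles does not matter.\<close>

lemma D_eq_0_imp_cst:
  assumes "D x = 0"
  obtains c where "x = cst c"
proof -
  obtain z where z: "reg x z"
    using eventually_reg[of x 0] eventually_happens' at_neq_bot by blast
  then obtain e where e: "e > 0" "\<And>w. w \<in> ball z e \<Longrightarrow> reg x w"
    using eventually_reg_nhds[of x z] by (auto simp: eventually_nhds_metric dist_commute)
  have "(mfun x has_field_derivative 0) (at w within ball z e)" if "w \<in> ball z e" for w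
    using reg_deriv[OF e(2)[OF that]] assms by (auto intro: has_field_derivative_at_within)
  then obtain c where c: "\<And>w. w \<in> ball z e \<Longrightarrow> mfun x w = c"
    using has_field_derivative_zero_constant[of "ball z e" "mfun x"] by auto
  have "eventually (\<lambda>w. w \<in> ball z e) (at z)"
    using e by (intro eventually_at_in_open') auto
  then have "eventually (\<lambda>w. reg x w \<and> reg (cst c) w \<longrightarrow> mfun x w = mfun (cst c) w) (at z)"
    by eventually_elim (auto simp: c)
  then have "x = cst c"
    by (intro mero_eqI[of _ _ z]) (auto intro: eventually_frequently)
  then show thesis
    by (rule that)
qed

text \<open>One substitution serves two purposes: with \<open>c = 1\<close> it is a translation, so
  that \<open>aff 1 \<omega> x = x\<close> says that \<open>\<omega>\<close> is a period, and with
  \<open>b = 0\<close> it is the pullback along a linear isomorphism.\<close>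

definition aff :: "complex \<Rightarrow> complex \<Rightarrow> mero \<Rightarrow> mero" where
  "aff c b x = Mero (\<lambda>z. mfun x (c * z + b))"

lemma filtermap_affine: "(c::complex) \<noteq> 0 \<Longrightarrow> filtermap (\<lambda>z. c * z + b) (at z) = at (c * z + b)"
proof -
  assume c: "c \<noteq> 0"
  show ?thesis
  proof (rule filtermap_fun_inverse[of "\<lambda>w. (w - b) / c"])
    show "filterlim (\<lambda>w. (w - b) / c) (at z) (at (c * z + b))"
      using c by (auto simp: filterlim_at eventually_at_filter field_simps intro!: tendsto_eq_intros)
    show "filterlim (\<lambda>z. c * z + b) (at (c * z + b)) (at z)"
      using c by (auto simp: filterlim_at eventually_at_filter intro!: tendsto_eq_intros)
  qed (use c in auto)
qed

lemma mfun_aff [simp]: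
  assumes "c \<noteq> 0"
  shows "mfun (aff c b x) = (\<lambda>z. mfun x (c * z + b))"
  unfolding aff_def
proof (rule mfun_Mero)
  have 1: "(\<lambda>z. mfun x (c * z + b)) meromorphic_on UNIV"
    by (rule meromorphic_on_compose[where A = UNIV]) (auto intro!: analytic_intros)
  have "remove_sings (\<lambda>z. mfun x (c * z + b)) = (\<lambda>z. mfun x (c * z + b))"
  proof
    fix z
    show "remove_sings (\<lambda>z. mfun x (c * z + b)) z = mfun x (c * z + b)"
      using remove_sings_compose[OF filtermap_affine[OF assms, of b z], of "mfun x"]
      by (simp add: o_def remove_sings_nicely_id)
  qed
  then show "(\<lambda>z. mfun x (c * z + b)) nicely_meromorphic_on UNIV"
    using remove_sings_closed[OF 1] by simp
qed

lemma reg_aff: 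
  assumes "c \<noteq> 0"
  shows "reg x (c * z + b) \<Longrightarrow> reg (aff c b x) z"
proof -
  assume r: "reg x (c * z + b)"
  have "(\<lambda>z. c * z + b) analytic_on {z}"
    by (intro analytic_intros)
  then show ?thesis
    using assms r analytic_on_compose[of "\<lambda>z. c * z + b" "{z}" "mfun x"]
    by (simp add: reg_def o_def)
qed

lemma eventually_affine:
  assumes "(c::complex) \<noteq> 0" "\<And>z. eventually P (at z)"
  shows "eventually (\<lambda>w. P (c * w + b)) (at z)"
  using assms(2)[of "c * z + b"] eventually_filtermap[of P "\<lambda>w. c * w + b" "at z"]
  by (simp add: filtermap_affine[OF assms(1)])

lemma aff_hom [simp]:
  assumes "c \<noteq> 0"
  shows "aff c b (x + y) = aff c b x + aff c b y" "aff c b (x * y) = aff c b x * aff c b y"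
    "aff c b (cst a) = cst a" "aff c b 0 = 0" "aff c b 1 = 1"
proof -
  have ev: "eventually (\<lambda>w. reg x (c * w + b) \<and> reg y (c * w + b)) (at 0)"
    using eventually_affine[OF assms eventually_reg, of x b 0] eventually_affine[OF assms eventually_reg, of y b 0]
    by eventually_elim auto
  have "eventually (\<lambda>w. mfun (aff c b (x + y)) w = mfun (aff c b x + aff c b y) w) (at 0)"
    "eventually (\<lambda>w. mfun (aff c b (x * y)) w = mfun (aff c b x * aff c b y) w) (at 0)"
    using ev by (eventually_elim; use assms in \<open>auto simp: reg_aff\<close>)+
  then show "aff c b (x + y) = aff c b x + aff c b y" "aff c b (x * y) = aff c b x * aff c b y"
    by (auto intro!: mero_eqI[of _ _ 0] eventually_frequently elim: eventually_mono)
  show "aff c b (cst a) = cst a" "aff c b 0 = 0" "aff c b 1 = 1"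
    using assms by (auto simp: mfun_inject[symmetric])
qed

lemma D_aff:
  assumes "c \<noteq> 0"
  shows "D (aff c b x) = cst c * aff c b (D x)"
proof (rule D_eqI[where P = "\<lambda>w. reg x (c * w + b)"])
  fix z show "eventually (\<lambda>w. reg x (c * w + b)) (at z)"
    by (rule eventually_affine[OF assms eventually_reg])
next
  fix w assume r: "reg x (c * w + b)"
  have "((\<lambda>w. mfun x (c * w + b)) has_field_derivative mfun (D x) (c * w + b) * c) (at w)"
    by (rule DERIV_chain2[where f = "mfun x" and g = "\<lambda>w. c * w + b", OF reg_deriv[OF r]]) (auto intro!: derivative_eq_intros)
  moreover have "reg (aff c b (D x)) w"
    using r assms by (intro reg_aff) auto
  ultimately show "(mfun (aff c b x) has_field_derivative mfun (cst c * aff c b (D x)) w) (at w)"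
    using assms by (simp add: mult.commute)
qed

section \<open>Fibres of solutions of autonomous differential equations\<close>

interpretation D: derivation D
  by unfold_locales (simp_all add: D_mult)

definition cpoly :: "complex poly \<Rightarrow> mero \<Rightarrow> mero" where
  "cpoly p x = poly (map_poly cst p) x"

text \<open>The value Q(x, y) of a polynomial in two variables, seen as a polynomial in
  \<open>y\<close> over the polynomials in \<open>x\<close>. Hence \<open>map_poly pderiv Q\<close>
  and \<open>pderiv Q\<close> are its partial derivatives.\<close>

definition bipoly :: "complex poly poly \<Rightarrow> mero \<Rightarrow> mero \<Rightarrow> mero" where
  "bipoly Q x y = poly (map_poly (\<lambda>p. cpoly p x) Q) y"

lemma cpoly_0 [simp]: "cpoly 0 x = 0"
  by (simp add: cpoly_def)

lemma cpoly_pCons [simp]: "cpoly (pCons a p) x = cst a + x * cpoly p x"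
  by (simp add: cpoly_def map_poly_pCons)

lemma cpoly_add [simp]: "cpoly (p + q) x = cpoly p x + cpoly q x"
proof -
  have "map_poly cst (p + q) = map_poly cst p + map_poly cst q"
    by (intro poly_eqI) (simp add: coeff_map_poly)
  then show ?thesis
    by (simp add: cpoly_def)
qed

lemma cpoly_1 [simp]: "cpoly 1 x = 1"
  by (simp add: cpoly_def)

lemma cpoly_monom [simp]: "cpoly (monom a n) x = cst a * x ^ n"
  by (simp add: cpoly_def map_poly_monom poly_monom)

lemma bipoly_0 [simp]: "bipoly 0 x y = 0"
  by (simp add: bipoly_def)

lemma bipoly_pCons [simp]: "bipoly (pCons p Q) x y = cpoly p x + y * bipoly Q x y"
  by (simp add: bipoly_def map_poly_pCons)

lemma bipoly_add [simp]: "bipoly (P + Q) x y = bipoly P x y + bipoly Q x y"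
proof -
  have "map_poly (\<lambda>p. cpoly p x) (P + Q) = map_poly (\<lambda>p. cpoly p x) P + map_poly (\<lambda>p. cpoly p x) Q"
    by (intro poly_eqI) (simp add: coeff_map_poly)
  then show ?thesis
    by (simp add: bipoly_def)
qed

lemma bipoly_sum: "bipoly (sum P A) x y = (\<Sum>a\<in>A. bipoly (P a) x y)"
  by (induction A rule: infinite_finite_induct) auto

lemma bipoly_monom [simp]: "bipoly (monom p n) x y = cpoly p x * y ^ n"
  by (simp add: bipoly_def map_poly_monom poly_monom)

lemma reg_cpoly [simp, intro]: "reg x z \<Longrightarrow> reg (cpoly p x) z"
  and mfun_cpoly [simp]: "reg x z \<Longrightarrow> mfun (cpoly p x) z = poly p (mfun x z)"
  by (induction p) auto

lemma reg_bipoly: "reg x z \<Longrightarrow> reg y z \<Longrightarrow> reg (bipoly Q x y) z"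
  by (induction Q) auto

lemma mfun_bipoly: "reg x z \<Longrightarrow> reg y z \<Longrightarrow>
    mfun (bipoly Q x y) z = poly (map_poly (\<lambda>p. poly p (mfun x z)) Q) (mfun y z)"
  by (induction Q) (auto simp: reg_bipoly map_poly_pCons)

lemma D_cpoly: "D (cpoly p x) = cpoly (pderiv p) x * D x"
  by (induction p) (auto simp: pderiv_pCons D_mult algebra_simps)

lemma D_bipoly: "D (bipoly Q x y) = bipoly (map_poly pderiv Q) x y * D x + bipoly (pderiv Q) x y * D y"
  by (induction Q) (auto simp: pderiv_pCons D_mult D_cpoly map_poly_pCons algebra_simps)

lemma aff_cpoly: "c \<noteq> 0 \<Longrightarrow> aff c b (cpoly p x) = cpoly p (aff c b x)"
  by (induction p) auto

lemma aff_bipoly: "c \<noteq> 0 \<Longrightarrow> aff c b (bipoly Q x y) = bipoly Q (aff c b x) (aff c b y)"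
  by (induction Q) (auto simp: aff_cpoly)

lemma aff_aff: "c \<noteq> 0 \<Longrightarrow> d \<noteq> 0 \<Longrightarrow> aff c b (aff d e x) = aff (d * c) (d * b + e) x"
  by (simp add: mfun_inject[symmetric] algebra_simps)

lemma aff_id [simp]: "aff 1 0 x = x"
  by (simp add: mfun_inject[symmetric])

lemma frequently_eq_imp_cst:
  assumes "frequently (\<lambda>w. mfun x w = c) (at z)"
  shows "x = cst c"
  by (rule mero_eqI[of _ _ z]) (use assms in \<open>auto elim: frequently_elim1\<close>)

text \<open>If \<open>p\<close> annihilated \<open>x\<close>, the values of \<open>x\<close> near 0
  would lie among finitely many roots; one of them would be taken at points accumulating at 0,
  making \<open>x\<close> constant.\<close>

lemma cpoly_nonzero:
  assumes "x \<notin> range cst" "p \<noteq> 0"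
  shows "cpoly p x \<noteq> 0"
proof
  assume 0: "cpoly p x = 0"
  have "eventually (\<lambda>w. \<exists>a\<in>{a. poly p a = 0}. mfun x w = a) (at 0)"
    using eventually_reg[of x 0]
  proof eventually_elim
    case (elim w)
    then show ?case
      using mfun_cpoly[of x w p] 0 by simp
  qed
  then have "frequently (\<lambda>w. \<exists>a\<in>{a. poly p a = 0}. mfun x w = a) (at 0)"
    by (rule eventually_frequently[rotated]) simp
  then obtain a where "frequently (\<lambda>w. mfun x w = a) (at 0)"
    using frequently_bex_finite[OF poly_roots_finite[OF assms(2)], of "\<lambda>w a. mfun x w = a" "at 0"] by blast
  then show False
    using frequently_eq_imp_cst assms(1) by blast
qed

lemma map_cpoly_nonzero:
  assumes "x \<notin> range cst" "Q \<noteq> 0"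
  shows "map_poly (\<lambda>p. cpoly p x) Q \<noteq> 0"
proof -
  have "coeff (map_poly (\<lambda>p. cpoly p x) Q) (degree Q) \<noteq> 0"
    using cpoly_nonzero[OF assms(1), of "lead_coeff Q"] assms(2) by (simp add: coeff_map_poly)
  then show ?thesis
    by auto
qed

definition alg_dep :: "mero \<Rightarrow> mero \<Rightarrow> bool" where
  "alg_dep x y \<longleftrightarrow> (\<exists>Q. Q \<noteq> 0 \<and> bipoly Q x y = 0)"

lemma alg_dep_refl: "alg_dep x x"
  unfolding alg_dep_def by (rule exI[of _ "[:[:0, -1:], 1:]"]) simp

text \<open>Factors of the second variable are cancelled one at a time, which is allowed because
  \<open>y\<close> is nonzero.\<close>

lemma alg_dep_const_coeff:
  assumes "bipoly Q x y = 0" "Q \<noteq> 0" "y \<noteq> 0"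
  obtains P where "bipoly P x y = 0" "coeff P 0 \<noteq> 0"
  using assms
proof (induction Q arbitrary: thesis)
  case (pCons p Q)
  show ?case
  proof (cases "p = 0")
    case True
    with pCons.prems have "bipoly Q x y = 0" "Q \<noteq> 0"
      by auto
    then show ?thesis
      using pCons.IH pCons.prems by blast
  next
    case False
    then show ?thesis
      using pCons.prems(1)[of "pCons p Q"] pCons.prems(2) by simp
  qed
qed simp

text \<open>Where \<open>y\<close> vanishes, the relation reduces to its constant coefficient in
  \<open>y\<close>, a nonzero polynomial with the value of \<open>x\<close> as a root. It will be
  applied to a separant in place of \<open>y\<close>.\<close>

lemma finite_values_at_zeros:
  assumes "alg_dep x y" "y \<noteq> 0"
  obtains B where "finite B" "\<And>z. reg x z \<Longrightarrow> reg y z \<Longrightarrow> mfun y z = 0 \<Longrightarrow> mfun x z \<in> B"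
proof -
  obtain Q where Q: "bipoly Q x y = 0" "coeff Q 0 \<noteq> 0"
    using assms alg_dep_const_coeff by (metis alg_dep_def)
  have "mfun x z \<in> {a. poly (coeff Q 0) a = 0}" if "reg x z" "reg y z" "mfun y z = 0" for z
    using mfun_bipoly[OF that(1,2), of Q] Q(1) that(3) by (simp add: poly_0_coeff_0 coeff_map_poly)
  then show thesis
    using that poly_roots_finite[OF Q(2)] by blast
qed

section \<open>Periods and algebraic dependence\<close>

lemma aff_of_nat_period:
  assumes "aff 1 \<omega> x = x"
  shows "aff 1 (of_nat n * \<omega>) x = x"
proof (induction n)
  case (Suc n)
  have "aff 1 \<omega> (aff 1 (of_nat n * \<omega>) x) = x"
    using Suc assms by simp
  then show ?case
    by (simp add: aff_aff algebra_simps)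
qed simp

lemma mfun_of_int_period:
  assumes "aff 1 \<omega> x = x"
  shows "mfun x (z + of_int n * \<omega>) = mfun x z"
proof -
  have *: "mfun x (z + of_nat k * \<omega>) = mfun x z" for z and k :: nat
    using mfun_aff[of 1 "of_nat k * \<omega>" x] aff_of_nat_period[OF assms, of k]
    by (metis mult_1 zero_neq_one)
  show ?thesis
  proof (cases n rule: int_cases2)
    case (nonpos m)
    then show ?thesis
      using *[of "z + of_int n * \<omega>" m] by simp
  qed (use * in simp)
qed

text \<open>Translation by multiples of \<open>\<omega>\<close> fixes the coefficients of the
  relation for \<open>y\<close> over \<open>x\<close>. All these translates of \<open>y\<close> are
  therefore roots of one nonzero polynomial, so two of them coincide.\<close>

lemma period_transfer:
  assumes "x \<notin> range cst" "alg_dep x y" "aff 1 \<omega> x = x"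
  obtains n :: nat where "n > 0" "aff 1 (of_nat n * \<omega>) y = y"
proof -
  obtain Q where Q: "Q \<noteq> 0" "bipoly Q x y = 0"
    using assms by (auto simp: alg_dep_def)
  note per = aff_of_nat_period[OF assms(3)]
  define R where "R = map_poly (\<lambda>p. cpoly p x) Q"
  have "poly R (aff 1 (of_nat k * \<omega>) y) = 0" for k
  proof -
    have "bipoly Q x (aff 1 (of_nat k * \<omega>) y) = aff 1 (of_nat k * \<omega>) (bipoly Q x y)"
      by (simp add: aff_bipoly per)
    then show ?thesis
      using Q(2) by (simp add: R_def bipoly_def)
  qed
  then have "range (\<lambda>k. aff 1 (of_nat k * \<omega>) y) \<subseteq> {t. poly R t = 0}"
    by auto
  moreover have "finite {t. poly R t = 0}"
    using map_cpoly_nonzero[OF assms(1) Q(1)] by (intro poly_roots_finite) (simp add: R_def)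
  ultimately have "finite (range (\<lambda>k::nat. aff 1 (of_nat k * \<omega>) y))"
    by (rule finite_subset)
  then have "\<not> inj (\<lambda>k::nat. aff 1 (of_nat k * \<omega>) y)"
    using range_inj_infinite by blast
  then obtain i j :: nat where "i < j" "aff 1 (of_nat i * \<omega>) y = aff 1 (of_nat j * \<omega>) y"
    by (metis (mono_tags, lifting) injI linorder_neqE_nat)
  then have "aff 1 (- of_nat i * \<omega>) (aff 1 (of_nat i * \<omega>) y) = aff 1 (- of_nat i * \<omega>) (aff 1 (of_nat j * \<omega>) y)"
    by simp
  then have "aff 1 (of_nat (j - i) * \<omega>) y = y"
    using \<open>i < j\<close> by (simp add: aff_aff of_nat_diff algebra_simps)
  then show thesis
    using \<open>i < j\<close> by (intro that[of "j - i"]) auto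
qed

text \<open>The differential algebra generated by a solution of an autonomous first-order equation, with
  the separant \<open>u\<close> inverted.\<close>

inductive_set diff_algebra :: "mero \<Rightarrow> mero \<Rightarrow> mero set" for x u where
  const: "cst c \<in> diff_algebra x u"
| fn: "x \<in> diff_algebra x u"
| deriv: "D x \<in> diff_algebra x u"
| inv: "inverse u \<in> diff_algebra x u"
| add: "a \<in> diff_algebra x u \<Longrightarrow> b \<in> diff_algebra x u \<Longrightarrow> a + b \<in> diff_algebra x u"
| mult: "a \<in> diff_algebra x u \<Longrightarrow> b \<in> diff_algebra x u \<Longrightarrow> a * b \<in> diff_algebra x u"

lemma cpoly_in_diff_algebra: "cpoly p x \<in> diff_algebra x u"
  using diff_algebra.const[of 0] by (induction p) (auto intro: diff_algebra.intros)

lemma bipoly_in_diff_algebra: "bipoly Q x (D x) \<in> diff_algebra x u"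
  using diff_algebra.const[of 0]
  by (induction Q) (auto intro: diff_algebra.add diff_algebra.mult diff_algebra.deriv cpoly_in_diff_algebra)

lemma uminus_in_diff_algebra: "a \<in> diff_algebra x u \<Longrightarrow> - a \<in> diff_algebra x u"
  using diff_algebra.mult[OF diff_algebra.const[of "-1"], of a] by simp

text \<open>Differentiating Q(x, x') = 0 gives an equation that is linear in x'' with the separant
  as its leading factor. With \<open>inverse u\<close> adjoined, x'' is expressed through x and x',
  and so are the derivatives of \<open>u\<close> and \<open>inverse u\<close>.\<close>

lemma D_in_diff_algebra:
  assumes Q: "bipoly Q x (D x) = 0" and u: "u = bipoly (pderiv Q) x (D x)" "u \<noteq> 0"
    and "a \<in> diff_algebra x u"
  shows "D a \<in> diff_algebra x u"
proof -
  note [intro] = diff_algebra.intros bipoly_in_diff_algebra uminus_in_diff_algebra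
  have "bipoly (map_poly pderiv Q) x (D x) * D x + u * D (D x) = 0"
    using D_bipoly[of Q x "D x"] Q u(1) by simp
  then have "D (D x) = - (bipoly (map_poly pderiv Q) x (D x) * D x) * inverse u"
    using u(2) by (simp add: field_simps add_eq_0_iff)
  also have "\<dots> \<in> diff_algebra x u"
    by blast
  finally have DD: "D (D x) \<in> diff_algebra x u" .
  have Du: "D u \<in> diff_algebra x u"
    unfolding u(1) D_bipoly using DD unfolding u(1) by blast
  have "D (inverse u) = - (D u * (inverse u * inverse u))"
    by (simp add: D.inverse divide_inverse power2_eq_square)
  with Du have Dinv: "D (inverse u) \<in> diff_algebra x u"
    by auto
  from assms(4) show ?thesis
  proof induction
    case (const c)
    then show ?case
      using diff_algebra.const[of 0] by simp
  next
    case (mult a b)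
    then show ?case
      unfolding D_mult by blast
  qed (use DD Dinv in \<open>auto intro: diff_algebra.intros\<close>)
qed

text \<open>Every element is a polynomial in x, x' and 1/u, so where \<open>u\<close> is nonzero its
  value is a function of the three values assumed equal.\<close>

lemma diff_algebra_eq_at:
  assumes "a \<in> diff_algebra x u" "reg x z1" "reg x z2" "mfun u z1 \<noteq> 0" "mfun u z2 \<noteq> 0"
    and "mfun x z1 = mfun x z2" "mfun (D x) z1 = mfun (D x) z2" "mfun u z1 = mfun u z2"
  shows "reg a z1 \<and> reg a z2 \<and> mfun a z1 = mfun a z2"
  using assms by induction auto

section \<open>Taylor coefficients through the derivation\<close>

lemma higher_deriv_mfun:
  assumes "reg x z"
  shows "reg ((D ^^ k) x) z" "mfun ((D ^^ k) x) z = (deriv ^^ k) (mfun x) z"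
proof -
  have *: "reg x z \<longrightarrow> reg ((D ^^ k) x) z \<and> mfun ((D ^^ k) x) z = (deriv ^^ k) (mfun x) z" for z
  proof (induction k arbitrary: z)
    case (Suc k)
    show ?case
    proof
      assume r: "reg x z"
      have "eventually (\<lambda>w. mfun ((D ^^ k) x) w = (deriv ^^ k) (mfun x) w) (nhds z)"
        using eventually_reg_nhds[OF r] by eventually_elim (use Suc in blast)
      then have "deriv (mfun ((D ^^ k) x)) z = deriv ((deriv ^^ k) (mfun x)) z"
        by (rule deriv_cong_ev) simp
      then show "reg ((D ^^ Suc k) x) z \<and> mfun ((D ^^ Suc k) x) z = (deriv ^^ Suc k) (mfun x) z"
        using Suc r by (auto simp: mfun_D_reg)
    qed
  qed simp
  show "reg ((D ^^ k) x) z" "mfun ((D ^^ k) x) z = (deriv ^^ k) (mfun x) z"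
    using assms * by blast+
qed

lemma D_iter_aff: "(D ^^ k) (aff 1 b x) = aff 1 b ((D ^^ k) x)"
  by (induction k) (auto simp: D_aff)

lemma mero_eq_if_derivs_eq:
  assumes "reg x z" "reg y z" "\<And>k. mfun ((D ^^ k) x) z = mfun ((D ^^ k) y) z"
  shows "x = y"
proof -
  have "eventually (\<lambda>w. reg x w \<and> reg y w) (nhds z)"
    using eventually_reg_nhds[OF assms(1)] eventually_reg_nhds[OF assms(2)] by eventually_elim auto
  then obtain e where e: "e > 0" "\<And>w. w \<in> ball z e \<Longrightarrow> reg x w \<and> reg y w"
    by (auto simp: eventually_nhds_metric dist_commute)
  have hol: "mfun x holomorphic_on ball z e" "mfun y holomorphic_on ball z e"
    using e(2) by (auto intro!: analytic_imp_holomorphic simp: reg_def analytic_on_analytic_at[of _ "ball z e"])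
  have "mfun x w = mfun y w" if "w \<in> ball z e" for w
    by (rule holomorphic_fun_eq_on_ball[OF hol that]) (use assms higher_deriv_mfun in metis)
  moreover have "eventually (\<lambda>w. w \<in> ball z e) (at z)"
    using e by (intro eventually_at_in_open') auto
  ultimately have "eventually (\<lambda>w. reg x w \<and> reg y w \<longrightarrow> mfun x w = mfun y w) (at z)"
    by (auto elim: eventually_mono)
  then show ?thesis
    by (intro mero_eqI[of _ _ z]) (auto intro: eventually_frequently)
qed

text \<open>By the differential equation, the Taylor series of \<open>x\<close> at a point of a generic fibre is
  determined by the value of \<open>x'\<close> there, for which there are finitely many candidates.\<close>

lemma generic_fibre:
  assumes "x \<notin> range cst" "alg_dep x (D x)" "\<And>Q. alg_dep x (bipoly Q x (D x))"
  obtains B where "finite B"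
    "\<And>a. a \<notin> B \<Longrightarrow> finite (mfun (D x) ` {z. mfun x z = a})"
    "\<And>z1 z2. mfun x z1 \<notin> B \<Longrightarrow> mfun x z2 = mfun x z1 \<Longrightarrow> mfun (D x) z2 = mfun (D x) z1 \<Longrightarrow>
       aff 1 (z2 - z1) x = x"
proof -
  let ?P = "\<lambda>Q. Q \<noteq> 0 \<and> bipoly Q x (D x) = 0"
  \<comment> \<open>Minimal degree in the second variable ensures that the separant, which has
    smaller degree, is not the zero function.\<close>
  obtain Q where Q: "Q \<noteq> 0" "bipoly Q x (D x) = 0" and least: "\<And>P. ?P P \<Longrightarrow> degree Q \<le> degree P"
    using assms(2) ex_has_least_nat[of ?P _ degree] unfolding alg_dep_def by metis
  have pos: "degree Q > 0"
  proof (rule Nat.gr0I)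
    assume "degree Q = 0"
    then obtain p where "Q = [:p:]"
      by (rule degree_eq_zeroE)
    then show False
      using Q cpoly_nonzero[OF assms(1), of p] by auto
  qed
  define u where "u = bipoly (pderiv Q) x (D x)"
  have u: "u \<noteq> 0"
    using least[of "pderiv Q"] pos by (auto simp: u_def pderiv_eq_0_iff degree_pderiv)
  obtain B1 where B1: "finite B1" "\<And>z. reg x z \<Longrightarrow> reg u z \<Longrightarrow> mfun u z = 0 \<Longrightarrow> mfun x z \<in> B1"
    using finite_values_at_zeros[OF _ u, of x] assms(3) unfolding u_def by blast
  \<comment> \<open>The value 0 is excluded because poles carry it, \<open>B1\<close> because the
    separant may vanish over it, and the roots of the leading coefficient so that the relation for
    \<open>D x\<close> stays nontrivial on the fibre.\<close>
  define B where "B = insert 0 (B1 \<union> {a. poly (lead_coeff Q) a = 0})"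
  have finB: "finite B"
    using B1 Q by (auto simp: B_def intro!: poly_roots_finite)
  have reg: "reg x z" "reg (D x) z" if "mfun x z \<notin> B" for z
    using that reg_if_nonzero[of x z] by (auto simp: B_def)
  show thesis
  proof (rule that[OF finB])
    fix a assume a: "a \<notin> B"
    define q where "q = map_poly (\<lambda>p. poly p a) Q"
    have "coeff q (degree Q) \<noteq> 0"
      using a by (simp add: q_def coeff_map_poly B_def)
    then have "q \<noteq> 0"
      by auto
    moreover have "mfun (D x) ` {z. mfun x z = a} \<subseteq> {b. poly q b = 0}"
      using Q(2) a reg mfun_bipoly[of x _ "D x" Q] by (force simp: q_def)
    ultimately show "finite (mfun (D x) ` {z. mfun x z = a})"
      using finite_subset poly_roots_finite by blast
  next
    fix z1 z2 assume z: "mfun x z1 \<notin> B" "mfun x z2 = mfun x z1" "mfun (D x) z2 = mfun (D x) z1"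
    have r: "reg x z1" "reg (D x) z1" "reg x z2" "reg (D x) z2"
      using reg[of z1] reg[of z2] z by auto
    then have ru: "reg u z1" "reg u z2"
      by (simp_all add: u_def reg_bipoly)
    then have nz: "mfun u z1 \<noteq> 0" "mfun u z2 \<noteq> 0"
      using B1(2)[OF r(1) ru(1)] B1(2)[OF r(3) ru(2)] z by (auto simp: B_def)
    have equ: "mfun u z1 = mfun u z2"
      using r z by (simp add: u_def mfun_bipoly)
    have "(D ^^ k) x \<in> diff_algebra x u" for k
      by (induction k) (auto intro: diff_algebra.fn D_in_diff_algebra[OF Q(2) u_def u])
    then have "mfun ((D ^^ k) x) z1 = mfun ((D ^^ k) x) z2" for k
      using diff_algebra_eq_at[of "(D ^^ k) x" x u z1 z2] r z nz equ by metis
    then show "aff 1 (z2 - z1) x = x"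
      using r by (intro mero_eq_if_derivs_eq[of _ z1]) (auto simp: reg_aff D_iter_aff)
  qed
qed

section \<open>Rationality from the great Picard theorem\<close>

lemma nicely_meromorphic_on_pointwise:
  "f nicely_meromorphic_on A \<longleftrightarrow> (\<forall>z\<in>A. f nicely_meromorphic_on {z})"
  unfolding nicely_meromorphic_on_def by (subst meromorphic_on_meromorphic_at) auto

lemma nicely_meromorphic_at_cong:
  assumes "eventually (\<lambda>w. f w = g w) (nhds z)" "g nicely_meromorphic_on {z}"
  shows "f nicely_meromorphic_on {z}"
proof -
  have ev: "eventually (\<lambda>w. f w = g w) (at z)" and eq: "f z = g z"
    using assms(1) by (auto simp: eventually_nhds_conv_at)
  have "f meromorphic_on {z} \<longleftrightarrow> g meromorphic_on {z}"
    using ev by (intro meromorphic_on_cong) auto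
  moreover have "is_pole f z \<longleftrightarrow> is_pole g z"
    using ev by (intro is_pole_cong) auto
  moreover have "(f \<midarrow>z\<rightarrow> f z) \<longleftrightarrow> (g \<midarrow>z\<rightarrow> f z)"
    using ev by (rule tendsto_cong)
  ultimately show ?thesis
    using assms(2) eq by (simp add: nicely_meromorphic_on_def)
qed

text \<open>The last hypothesis makes \<open>g\<close> tend to \<open>g z\<close> through a
  punctured neighbourhood, so that both limits and poles of \<open>f\<close> are carried
  over.\<close>

lemma nicely_meromorphic_on_compose:
  assumes "f nicely_meromorphic_on A" "g analytic_on B" "g ` B \<subseteq> A"
    and "\<And>z. z \<in> B \<Longrightarrow> eventually (\<lambda>w. g w \<noteq> g z) (at z)"
  shows "(\<lambda>z. f (g z)) nicely_meromorphic_on B"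
  unfolding nicely_meromorphic_on_def
proof (intro conjI ballI)
  show "(\<lambda>z. f (g z)) meromorphic_on B"
    by (rule meromorphic_on_compose[of f A]) (use assms(1-3) in \<open>simp_all add: nicely_meromorphic_on_def\<close>)
next
  fix z assume z: "z \<in> B"
  have "g analytic_on {z}"
    using assms(2) z analytic_on_analytic_at by blast
  then have "g \<midarrow>z\<rightarrow> g z"
    by (simp add: analytic_at_imp_isCont isContD)
  then have lim: "filterlim g (at (g z)) (at z)"
    using assms(4)[OF z] by (simp add: filterlim_at)
  have "is_pole f (g z) \<and> f (g z) = 0 \<or> f \<midarrow>g z\<rightarrow> f (g z)"
    using assms(1,3) z by (auto simp: nicely_meromorphic_on_def)
  then show "is_pole (\<lambda>z. f (g z)) z \<and> f (g z) = 0 \<or> (\<lambda>z. f (g z)) \<midarrow>z\<rightarrow> f (g z)"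
    using filterlim_compose[OF _ lim] unfolding is_pole_def by blast
qed

text \<open>It serves twice below: to choose the multiplicities that clear the finite poles and,
  after inversion of the variable, to bound the growth at infinity.\<close>

lemma meromorphic_at_imp_power_mult_tendsto:
  assumes "f meromorphic_on {z}"
  obtains k c where "((\<lambda>w. (w - z) ^ k * f w) \<longlongrightarrow> c) (at z)"
proof -
  have iso: "isolated_singularity_at f z" and "not_essential f z"
    using assms by (auto simp: meromorphic_at_iff)
  then consider c where "f \<midarrow>z\<rightarrow> c" | "is_pole f z"
    by (auto simp: not_essential_def)
  then show thesis
  proof cases
    case (1 c)
    then show ?thesis
      by (intro that[of 0]) auto
  next
    case 2
    obtain r where r: "r > 0" "f holomorphic_on ball z r - {z}"
      using iso by (auto simp: isolated_singularity_at_def dest: analytic_imp_holomorphic)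
    define g n where "g = zor_poly f z" and "n = nat (- zorder f z)"
    obtain e where e: "e > 0" "g holomorphic_on cball z e" "\<And>w. w \<in> cball z e - {z} \<Longrightarrow> f w = g w / (w - z) ^ n"
      using zorder_exist_pole[OF r(2) _ _ 2] r(1) by (auto simp: g_def n_def)
    have "g analytic_on {z}"
      using e(1,2) by (metis analytic_at ball_subset_cball centre_in_ball holomorphic_on_subset open_ball)
    then have "g \<midarrow>z\<rightarrow> g z"
      by (simp add: analytic_at_imp_isCont isContD)
    moreover have "eventually (\<lambda>w. w \<in> ball z e - {z}) (at z)"
      using e(1) by (intro eventually_at_in_open) auto
    then have "eventually (\<lambda>w. (w - z) ^ n * f w = g w) (at z)"
      by eventually_elim (use e(3) in auto)
    ultimately have "((\<lambda>w. (w - z) ^ n * f w) \<longlongrightarrow> g z) (at z)"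
      by (simp add: tendsto_cong)
    then show ?thesis
      by (rule that)
  qed
qed

text \<open>Meromorphy at infinity confines the singularities to a disc, so they are finitely many.
  Clearing them with a polynomial leaves an entire function of polynomial growth, which is a
  polynomial by Liouville.\<close>

lemma meromorphic_on_sphere_imp_rational:
  assumes f: "f meromorphic_on UNIV" and inf: "(\<lambda>w. f (inverse w)) meromorphic_on {0}"
  obtains p q where "q \<noteq> 0" "\<And>z. eventually (\<lambda>w. f w * poly q w = poly p w) (at z)"
proof -
  have iso: "isolated_singularity_at (\<lambda>w. f (inverse w)) 0"
    using inf by (simp add: meromorphic_at_iff)
  then obtain r where r: "r > 0" "(\<lambda>w. f (inverse w)) analytic_on ball 0 r - {0}"
    by (auto simp: isolated_singularity_at_def)
  define S where "S = {z. \<not> f analytic_on {z}}"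
  have "S \<subseteq> cball 0 (inverse r)"
  proof
    fix z assume z: "z \<in> S"
    show "z \<in> cball 0 (inverse r)"
    proof (rule ccontr)
      assume "z \<notin> cball 0 (inverse r)"
      then have nz: "z \<noteq> 0" and "inverse r < norm z"
        using r(1) by auto
      then have "inverse z \<in> ball 0 r - {0}"
        using r(1) less_imp_inverse_less[of "inverse r" "norm z"] by (simp add: norm_inverse)
      then have "(\<lambda>w. f (inverse w)) analytic_on {inverse z}"
        using r(2) by (meson analytic_on_analytic_at)
      moreover have "inverse analytic_on {z}"
        using nz by (intro analytic_on_inverse analytic_on_ident[unfolded id_def]) auto
      ultimately have "((\<lambda>w. f (inverse w)) \<circ> inverse) analytic_on {z}"
        by (intro analytic_on_compose) auto
      then show False
        using z by (simp add: S_def o_def)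
    qed
  qed
  moreover have "\<not> z islimpt S" for z
    using meromorphic_on_imp_not_islimpt_singularities[OF f] by (simp add: S_def)
  ultimately have fin: "finite S"
    using compact_cball[of "0::complex" "inverse r"] unfolding compact_eq_Bolzano_Weierstrass by metis
  have "\<forall>z. \<exists>k c. ((\<lambda>w. (w - z) ^ k * f w) \<longlongrightarrow> c) (at z)"
    using meromorphic_at_imp_power_mult_tendsto meromorphic_on_subset[OF f subset_UNIV] by metis
  then obtain k c where kc: "\<And>z. ((\<lambda>w. (w - z) ^ k z * f w) \<longlongrightarrow> c z) (at z)"
    by metis
  define q where "q = (\<Prod>z\<in>S. [:- z, 1:] ^ k z)"
  have q: "q \<noteq> 0"
    using fin by (simp add: q_def)
  define g where "g = (\<lambda>w. f w * poly q w)"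
  have an_q: "(\<lambda>w. poly q w) analytic_on A" for A
    unfolding poly_altdef by (intro analytic_intros)
  have g: "g meromorphic_on UNIV"
    unfolding g_def by (intro meromorphic_on_mult f analytic_on_imp_meromorphic_on an_q)
  have an: "remove_sings g analytic_on {z}" for z
  proof (cases "z \<in> S")
    case False
    then have "g analytic_on {z}"
      unfolding g_def by (intro analytic_on_mult an_q) (simp add: S_def)
    then show ?thesis
      by (rule remove_sings_analytic_on)
  next
    case True
    then have "poly q w = (w - z) ^ k z * (\<Prod>y\<in>S - {z}. (w - y) ^ k y)" for w
      using fin by (simp add: q_def poly_prod prod.remove poly_power)
    then have "g = (\<lambda>w. ((w - z) ^ k z * f w) * (\<Prod>y\<in>S - {z}. (w - y) ^ k y))"
      by (simp add: g_def fun_eq_iff mult_ac)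
    moreover have "((\<lambda>w. ((w - z) ^ k z * f w) * (\<Prod>y\<in>S - {z}. (w - y) ^ k y)) \<longlongrightarrow>
        c z * (\<Prod>y\<in>S - {z}. (z - y) ^ k y)) (at z)"
      by (intro tendsto_intros kc)
    ultimately show ?thesis
      using g by (intro remove_sings_analytic_at) (auto intro!: meromorphic_on_isolated_singularity intro: meromorphic_on_subset)
  qed
  then have hol: "remove_sings g holomorphic_on UNIV"
    using analytic_imp_holomorphic analytic_on_analytic_at by blast
  have ev_inv: "eventually (\<lambda>w. remove_sings g w = g w) (at z)" for z
    by (rule mero_eventually_remove_sings[OF g])
  have "(\<lambda>w. poly q (inverse w)) meromorphic_on {0}"
    unfolding poly_altdef by (intro meromorphic_intros)
  then have "(\<lambda>w. g (inverse w)) meromorphic_on {0}"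
    unfolding g_def by (intro meromorphic_on_mult inf)
  then obtain n l where nl: "((\<lambda>w. (w - 0) ^ n * g (inverse w)) \<longlongrightarrow> l) (at 0)"
    by (rule meromorphic_at_imp_power_mult_tendsto)
  then have "eventually (\<lambda>w. dist ((w - 0) ^ n * g (inverse w)) l < 1) (at 0)"
    by (rule tendstoD) simp
  then obtain d where d: "d > 0"
      "\<And>w. w \<noteq> 0 \<Longrightarrow> norm w < d \<Longrightarrow> dist (w ^ n * g (inverse w)) l < 1"
    by (auto simp: eventually_at)
  \<comment> \<open>The first bound makes \<open>norm (inverse z) < d\<close>; the second puts
    \<open>z\<close> outside the disc that contains \<open>S\<close>.\<close>
  define A where "A = max (2 / d) (1 + inverse r)"
  have bound: "norm (remove_sings g z) \<le> (norm l + 1) * norm z ^ n" if z: "A \<le> norm z" for z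
  proof -
    have "inverse r < norm z" "2 / d \<le> norm z"
      using z by (auto simp: A_def)
    then have "z \<noteq> 0"
      using positive_imp_inverse_positive[OF r(1)] by auto
    have "z \<notin> S"
      using \<open>inverse r < norm z\<close> \<open>S \<subseteq> cball 0 (inverse r)\<close> by auto
    then have "g analytic_on {z}"
      unfolding g_def by (intro analytic_on_mult an_q) (simp add: S_def)
    then have eq: "remove_sings g z = g z"
      by simp
    have "2 \<le> norm z * d"
      using \<open>2 / d \<le> norm z\<close> d(1) by (simp add: field_simps)
    then have "1 < norm z * d"
      by linarith
    then have "norm (inverse z) < d"
      using \<open>z \<noteq> 0\<close> by (simp add: norm_inverse norm_divide field_simps)
    then have "dist (inverse z ^ n * g z) l < 1"
      using d(2)[of "inverse z"] \<open>z \<noteq> 0\<close> by simp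
    then have "norm (inverse z ^ n * g z) \<le> norm l + 1"
      using norm_triangle_ineq2[of "inverse z ^ n * g z" l] by (simp add: dist_norm)
    then show ?thesis
      unfolding eq using \<open>z \<noteq> 0\<close> by (simp add: norm_mult norm_power norm_inverse norm_divide field_simps)
  qed
  define p where "p = (\<Sum>i\<le>n. monom ((deriv ^^ i) (remove_sings g) 0 / fact i) i)"
  have poly: "remove_sings g z = poly p z" for z
    using Liouville_polynomial[OF hol bound, where ?\<xi> = z] by (simp add: p_def poly_sum poly_monom)
  have "eventually (\<lambda>w. f w * poly q w = poly p w) (at z)" for z
    using ev_inv[of z] unfolding poly by eventually_elim (simp add: g_def)
  with q show thesis
    by (rule that)
qed

text \<open>The great Picard theorem concerns holomorphic functions, whereas \<open>f\<close> may
  have poles. \<open>h\<close> moves \<open>c\<close> to infinity, so that poles of \<open>f\<close>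
  become zeros of an analytic function; the images of \<open>a\<close> and \<open>b\<close> remain
  omitted values.\<close>

lemma meromorphic_at_if_omits_three_values:
  assumes f: "f nicely_meromorphic_on ball z0 r - {z0}" and r: "r > 0"
    and abc: "a \<noteq> b" "a \<noteq> c" "b \<noteq> c" and omit: "\<And>w. w \<in> ball z0 r - {z0} \<Longrightarrow> f w \<notin> {a, b, c}"
  shows "f meromorphic_on {z0}"
proof -
  let ?U = "ball z0 r - {z0}"
  define h where "h = remove_sings (\<lambda>w. inverse (f w - c))"
  have h: "h analytic_on {w} \<and> (is_pole f w \<and> h w = 0 \<or> h w = inverse (f w - c))" if w: "w \<in> ?U" for w
  proof -
    have mero: "(\<lambda>w. inverse (f w - c)) meromorphic_on {w}"
      using f w by (intro meromorphic_intros) (auto simp: nicely_meromorphic_on_def intro: meromorphic_on_subset)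
    then have iso: "isolated_singularity_at (\<lambda>w. inverse (f w - c)) w"
      by (simp add: meromorphic_at_iff)
    have "is_pole f w \<or> f \<midarrow>w\<rightarrow> f w"
      using f w by (auto simp: nicely_meromorphic_on_def)
    then show ?thesis
    proof
      assume pole: "is_pole f w"
      then have "is_pole (\<lambda>w. f w - c) w"
        by (simp add: is_pole_minus_const_iff)
      then have "(\<lambda>w. inverse (f w - c)) \<midarrow>w\<rightarrow> 0"
        by (simp add: is_pole_def filterlim_compose[OF tendsto_inverse_0])
      then show ?thesis
        using pole remove_sings_analytic_at[OF iso] unfolding h_def by (auto simp: remove_sings_eqI)
    next
      assume "f \<midarrow>w\<rightarrow> f w"
      then have "(\<lambda>w. inverse (f w - c)) \<midarrow>w\<rightarrow> inverse (f w - c)"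
        using omit[OF w] by (intro tendsto_intros) auto
      then show ?thesis
        using remove_sings_analytic_at[OF iso] unfolding h_def by (auto simp: remove_sings_eqI)
    qed
  qed
  have an: "h analytic_on ?U"
    using h analytic_on_analytic_at by blast
  \<comment> \<open>The image of \<open>a\<close> is moved to infinity. Then \<open>k\<close> is
    analytic and omits 0, which corresponds to the value \<open>c\<close> of \<open>f\<close>, and
    the image of \<open>b\<close>.\<close>
  define k where "k = (\<lambda>w. inverse (h w - inverse (a - c)))"
  have h_neq: "h w \<noteq> inverse (a - c) \<and> h w \<noteq> inverse (b - c)" if "w \<in> ?U" for w
    using h[OF that] omit[OF that] abc by auto
  then have an_k: "k analytic_on ?U"
    unfolding k_def using an by (intro analytic_intros) auto
  have iso: "isolated_singularity_at h z0" "isolated_singularity_at k z0"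
    using an an_k r by (auto simp: isolated_singularity_at_def)
  have evU: "eventually (\<lambda>w. w \<in> ?U) (at z0)"
    using r by (intro eventually_at_in_open) auto
  have "k w \<noteq> 0 \<and> k w \<noteq> inverse (inverse (b - c) - inverse (a - c))" if "w \<in> ?U" for w
    using h_neq[OF that] by (auto simp: k_def)
  moreover have "inverse (inverse (b - c) - inverse (a - c)) \<noteq> 0"
    using abc by auto
  ultimately obtain l where "(k \<longlongrightarrow> l) (at z0) \<or> ((inverse \<circ> k) \<longlongrightarrow> l) (at z0)"
    using great_Picard[of "ball z0 r" z0 0 "inverse (inverse (b - c) - inverse (a - c))" k]
      analytic_imp_holomorphic[OF an_k] r by (metis centre_in_ball open_ball)
  then have mero_h: "h meromorphic_on {z0}"
  proof
    assume "(k \<longlongrightarrow> l) (at z0)"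
    then have "k meromorphic_on {z0}"
      using iso by (auto simp: meromorphic_at_iff not_essential_def)
    then have "(\<lambda>w. inverse (k w) + inverse (a - c)) meromorphic_on {z0}"
      by (intro meromorphic_intros)
    then show ?thesis
      by (simp add: k_def)
  next
    assume "((inverse \<circ> k) \<longlongrightarrow> l) (at z0)"
    then have "((\<lambda>w. inverse (k w) + inverse (a - c)) \<longlongrightarrow> l + inverse (a - c)) (at z0)"
      by (intro tendsto_intros) (simp add: o_def)
    then show ?thesis
      using iso by (auto simp: k_def meromorphic_at_iff not_essential_def)
  qed
  from mero_h have "(\<lambda>w. c + inverse (h w)) meromorphic_on {z0}"
    by (intro meromorphic_intros)
  moreover have "eventually (\<lambda>w. f w = c + inverse (h w)) (at z0)"
  proof -
    \<comment> \<open>Zeros of \<open>h\<close> are poles of \<open>f\<close>. If they accumulated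
      at \<open>z0\<close>, \<open>h\<close> would vanish near \<open>z0\<close> and poles of
      \<open>f\<close> would fill a punctured neighbourhood, although poles are isolated.\<close>
    have "eventually (\<lambda>w. h w \<noteq> 0) (at z0)"
    proof (rule ccontr)
      assume "\<not> eventually (\<lambda>w. h w \<noteq> 0) (at z0)"
      then have "frequently (\<lambda>w. h w = 0) (at z0)"
        by (simp add: frequently_def)
      then have "eventually (\<lambda>w. h w = 0) (at z0)"
        using not_essential_frequently_0_imp_eventually_0[OF iso(1)] mero_h
        by (simp add: meromorphic_at_iff)
      then have "eventually (\<lambda>w. w \<in> ?U \<and> h w = 0) (at z0)"
        using evU by eventually_elim auto
      then obtain S where S: "open S" "z0 \<in> S" "\<And>w. w \<in> S - {z0} \<Longrightarrow> w \<in> ?U \<and> h w = 0"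
        unfolding eventually_at_topological by auto
      have pole: "is_pole f w" if "w \<in> S - {z0}" for w
        using S(3)[OF that] h[of w] omit[of w] by auto
      have "eventually (\<lambda>w. w \<in> S - {z0}) (at z0)"
        using S by (intro eventually_at_in_open) auto
      then obtain w where w: "w \<in> S - {z0}"
        using eventually_happens' at_neq_bot by blast
      have "f meromorphic_on {w}"
        using f S(3)[OF w] by (auto simp: nicely_meromorphic_on_def intro: meromorphic_on_subset)
      then have "eventually (\<lambda>v. \<not> is_pole f v) (at w)"
        by (intro eventually_not_pole) (simp add: meromorphic_at_iff)
      moreover have "eventually (\<lambda>v. v \<in> S - {z0}) (at w)"
        using S w by (intro eventually_at_in_open') auto
      ultimately have "eventually (\<lambda>v. False) (at w)"
        by eventually_elim (use pole in auto)
      then show False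
        by simp
    qed
    with evU show ?thesis
    proof eventually_elim
      case (elim w)
      with h[of w] have "h w = inverse (f w - c)"
        by auto
      then show ?case
        by simp
    qed
  qed
  ultimately show ?thesis
    by (subst meromorphic_on_cong) auto
qed


lemma nicely_meromorphic_on_inverse_arg:
  assumes "f nicely_meromorphic_on - {0}"
  shows "(\<lambda>w. f (inverse w)) nicely_meromorphic_on - {0}"
proof (rule nicely_meromorphic_on_compose[OF assms])
  show "inverse analytic_on - {0::complex}"
    using analytic_on_inverse[OF analytic_on_ident, of "- {0}"] by simp
qed (auto simp: eventually_at_filter)

lemma meromorphic_at_0_if_three_finite_fibres:
  assumes f: "f nicely_meromorphic_on - {0}" and abc: "a \<noteq> b" "a \<noteq> c" "b \<noteq> c"
    and fin: "\<And>t. t \<in> {a, b, c} \<Longrightarrow> finite {w. w \<noteq> 0 \<and> f w = t}"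
  shows "f meromorphic_on {0}"
proof -
  define F where "F = {w. w \<noteq> 0 \<and> f w = a} \<union> {w. w \<noteq> 0 \<and> f w = b} \<union> {w. w \<noteq> 0 \<and> f w = c}"
  have "finite F"
    using fin by (simp add: F_def)
  moreover have "0 \<notin> F"
    by (simp add: F_def)
  ultimately have "open (- F)" "0 \<in> - F"
    by (auto intro: finite_imp_closed)
  then obtain r where r: "r > 0" "ball 0 r \<subseteq> - F"
    using open_contains_ball by blast
  show ?thesis
    by (rule meromorphic_at_if_omits_three_values[OF _ r(1) abc])
      (use r(2) f in \<open>auto simp: F_def intro: nicely_meromorphic_on_subset\<close>)
qed

text \<open>The domain is the punctured plane because that is where a periodic function lives once
  it is written in terms of an exponential. Inversion exchanges the ends 0 and infinity, so one
  local result covers both.\<close>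

lemma rational_if_three_finite_fibres:
  assumes f: "f nicely_meromorphic_on - {0}" and abc: "a \<noteq> b" "a \<noteq> c" "b \<noteq> c"
    and fin: "\<And>t. t \<in> {a, b, c} \<Longrightarrow> finite {w. w \<noteq> 0 \<and> f w = t}"
  shows "\<exists>p q. q \<noteq> 0 \<and> (\<forall>z. eventually (\<lambda>w. f w * poly q w = poly p w) (at z))"
proof -
  have "f meromorphic_on {0}"
    by (rule meromorphic_at_0_if_three_finite_fibres[OF assms])
  moreover have "f meromorphic_on - {0}"
    using f by (simp add: nicely_meromorphic_on_def)
  ultimately have "f meromorphic_on UNIV"
    using meromorphic_on_Un[of f "{0}" "- {0}"] by simp
  moreover have "(\<lambda>w. f (inverse w)) meromorphic_on {0}"
  proof (rule meromorphic_at_0_if_three_finite_fibres[OF nicely_meromorphic_on_inverse_arg[OF f] abc])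
    fix t assume "t \<in> {a, b, c}"
    then have "finite (inverse ` {w. w \<noteq> 0 \<and> f w = t})"
      using fin by blast
    moreover have "{w. w \<noteq> 0 \<and> f (inverse w) = t} \<subseteq> inverse ` {w. w \<noteq> 0 \<and> f w = t}"
    proof
      fix w assume "w \<in> {w. w \<noteq> 0 \<and> f (inverse w) = t}"
      then show "w \<in> inverse ` {w. w \<noteq> 0 \<and> f w = t}"
        by (intro image_eqI[of w inverse "inverse w"]) auto
    qed
    ultimately show "finite {w. w \<noteq> 0 \<and> f (inverse w) = t}"
      by (rule finite_subset[rotated])
  qed
  ultimately show ?thesis
    using meromorphic_on_sphere_imp_rational by metis
qed

section \<open>Subfields and algebraic dependence\<close>

lemma generate_field_subset:
  assumes "subfield_of S" "H \<subseteq> mfun ` S"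
  shows "generate_field mero_field H \<subseteq> mfun ` S"
proof
  interpret subfield_of S by fact
  fix f assume "f \<in> generate_field mero_field H"
  then show "f \<in> mfun ` S"
  proof induction
    case one
    then show ?case
      using one_in by (metis image_eqI mfun_ring(2))
  next
    case (incl h)
    then show ?case
      using assms(2) by auto
  next
    case (a_inv h)
    then show ?case
      using uminus_in by (metis (no_types, lifting) image_iff mfun_ring(5))
  next
    case (m_inv h)
    then obtain x where x: "x \<in> S" "h = mfun x" "x \<noteq> 0"
      by (metis (no_types, lifting) image_iff mfun_ring(1))
    then show ?case
      using inverse_in mfun_inv by (metis image_eqI)
  next
    case (eng_add h1 h2)
    then show ?case
      using add_in by (metis (no_types, lifting) image_iff mfun_ring(3))
  next
    case (eng_mult h1 h2)
    then show ?case
      using mult_in by (metis (no_types, lifting) image_iff mfun_ring(4))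
  qed
qed

lemma subfield_of_if_subfield:
  assumes "subfield K mero_field"
  shows "subfield_of {x. mfun x \<in> K}"
proof
  interpret K: subfield K mero_field by fact
  fix a b :: mero
  show "1 \<in> {x. mfun x \<in> K}"
    using K.one_closed by (simp only: mem_Collect_eq mfun_ring)
  assume a: "a \<in> {x. mfun x \<in> K}"
  {
    assume "b \<in> {x. mfun x \<in> K}"
    with a show "a * b \<in> {x. mfun x \<in> K}"
      using K.m_closed by (simp only: mem_Collect_eq mfun_ring)
    have "mfun (a + - b) \<in> K"
      using a \<open>b \<in> _\<close> subringE(5,7)[OF subfieldE(1)[OF assms]] unfolding mfun_ring by auto
    then show "a - b \<in> {x. mfun x \<in> K}"
      by simp
  }
  show "inverse a \<in> {x. mfun x \<in> K}"
  proof (cases "a = 0")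
    case False
    then have "mfun a \<in> K - {\<zero>\<^bsub>mero_field\<^esub>}"
      using a by (metis (no_types, lifting) DiffI mem_Collect_eq mfun_inject mfun_ring(1) singletonD)
    then show ?thesis
      using MF.subfield_m_inv(1)[OF assms] False by (simp add: mfun_inv)
  qed (use a in simp)
qed

lemma subfield_eq_mfun_image:
  assumes "subfield K mero_field"
  shows "K = mfun ` {x. mfun x \<in> K}"
proof -
  have "K \<subseteq> carrier mero_field"
    using subfieldE(3)[OF assms] .
  then have "mfun (Mero f) = f" if "f \<in> K" for f
    using that by (simp add: Mero_inverse subset_iff)
  then show ?thesis
    by (auto simp: image_iff) metis
qed

lemma const_funs_eq: "const_funs = mfun ` range cst"
  by (simp add: const_funs_def image_image)

section \<open>Algebraic independence as absence of polynomial relations\<close>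

lemma mfun_sum: "finite A \<Longrightarrow> mfun (sum h A) = finsum mero_field (\<lambda>a. mfun (h a)) A"
  by (induction rule: finite_induct) (auto simp: mfun_ring simp del: mfun_0)

lemma mfun_prod: "finite A \<Longrightarrow> mfun (prod h A) = finprod mero_field (\<lambda>a. mfun (h a)) A"
  by (induction rule: finite_induct) (auto simp: mfun_ring simp del: mfun_1)

lemma mfun_power: "mfun (x ^ n) = mfun x [^]\<^bsub>mero_field\<^esub> n"
  by (induction n) (simp_all add: mfun_ring MF.m_comm del: mfun_1)

lemma eval_monom_mfun:
  assumes "finite S" "set_mset m \<subseteq> mfun ` S"
  shows "eval_monom mero_field m = mfun (\<Prod>x\<in>S. x ^ count m (mfun x))"
proof -
  have "eval_monom mero_field m = finprod mero_field (\<lambda>f. f [^]\<^bsub>mero_field\<^esub> count m f) (mfun ` S)"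
    unfolding eval_monom_def
    using assms by (intro MF.finprod_mono_neutral_cong_left) (auto simp: not_in_iff)
  also have "\<dots> = finprod mero_field (\<lambda>x. mfun x [^]\<^bsub>mero_field\<^esub> count m (mfun x)) S"
    by (intro MF.finprod_reindex) (auto simp: inj_on_def mfun_inject)
  finally show ?thesis
    using assms by (simp add: mfun_prod mfun_power)
qed

lemma not_alg_independentE:
  assumes "\<not> alg_independent mero_field const_funs (mfun ` S)" "finite S"
  obtains M c m0 where "finite M" "\<And>m. m \<in> M \<Longrightarrow> set_mset m \<subseteq> mfun ` S" "m0 \<in> M" "c m0 \<noteq> 0"
    "(\<Sum>m\<in>M. cst (c m) * (\<Prod>x\<in>S. x ^ count m (mfun x))) = 0"
proof -
  obtain M c m0 where M: "finite M" "\<forall>m\<in>M. set_mset m \<subseteq> mfun ` S" "\<forall>m\<in>M. c m \<in> const_funs"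
      "finsum mero_field (\<lambda>m. c m \<otimes>\<^bsub>mero_field\<^esub> eval_monom mero_field m) M = \<zero>\<^bsub>mero_field\<^esub>"
      "m0 \<in> M" "c m0 \<noteq> \<zero>\<^bsub>mero_field\<^esub>"
    using assms(1) by (auto simp: alg_independent_def)
  then have "\<forall>m\<in>M. \<exists>a. c m = mfun (cst a)"
    by (auto simp: const_funs_def)
  then obtain a where a: "\<And>m. m \<in> M \<Longrightarrow> c m = mfun (cst (a m))"
    by metis
  have "mfun (\<Sum>m\<in>M. cst (a m) * (\<Prod>x\<in>S. x ^ count m (mfun x))) =
      finsum mero_field (\<lambda>m. c m \<otimes>\<^bsub>mero_field\<^esub> eval_monom mero_field m) M"
    unfolding mfun_sum[OF M(1)]
    using M a assms(2) by (intro MF.finsum_cong') (auto simp: mfun_ring(4) eval_monom_mfun simp del: mfun_cst)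
  then have "(\<Sum>m\<in>M. cst (a m) * (\<Prod>x\<in>S. x ^ count m (mfun x))) = 0"
    unfolding M(4) mfun_ring(1)[symmetric] by (simp only: mfun_inject)
  moreover have "a m0 \<noteq> 0"
    using M(5,6) a[of m0] by (metis cst_hom(1) mfun_ring(1))
  ultimately show thesis
    using M that by blast
qed

lemma alg_dep_if_not_independent:
  assumes "\<not> alg_independent mero_field const_funs {mfun x, mfun y}" "x \<noteq> y"
  shows "alg_dep x y"
proof -
  have dep: "\<not> alg_independent mero_field const_funs (mfun ` {x, y})" "finite {x, y}"
    using assms(1) by auto
  obtain M c m0 where M: "finite M" "\<And>m. m \<in> M \<Longrightarrow> set_mset m \<subseteq> mfun ` {x, y}" "m0 \<in> M" "c m0 \<noteq> 0"
      "(\<Sum>m\<in>M. cst (c m) * (\<Prod>t\<in>{x, y}. t ^ count m (mfun t))) = 0"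
    by (rule not_alg_independentE[OF dep]) (rule that)
  \<comment> \<open>Each monomial is encoded by its two multiplicities. These determine it, so
    distinct monomials stay apart and \<open>Q\<close> keeps the nonzero coefficient of
    \<open>m0\<close>.\<close>
  define Q where "Q = (\<Sum>m\<in>M. monom (monom (c m) (count m (mfun x))) (count m (mfun y)))"
  have "bipoly Q x y = 0"
    using M(5) assms(2) by (simp add: Q_def bipoly_sum mult_ac)
  moreover have "coeff (coeff Q (count m0 (mfun y))) (count m0 (mfun x)) = (\<Sum>m\<in>M. if m = m0 then c m else 0)"
  proof -
    have "m = m0" if "m \<in> M" "count m (mfun x) = count m0 (mfun x)" "count m (mfun y) = count m0 (mfun y)" for m
    proof (rule multiset_eqI)
      fix f
      show "count m f = count m0 f"
      proof (cases "f \<in> mfun ` {x, y}")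
        case False
        then have "f \<notin># m" "f \<notin># m0"
          using that(1) M(2)[of m] M(2)[of m0] M(3) by blast+
        then show ?thesis
          by (simp add: not_in_iff)
      qed (use that in auto)
    qed
    then show ?thesis
      unfolding Q_def coeff_sum by (intro sum.cong) auto
  qed
  then have "Q \<noteq> 0"
    using M by auto
  ultimately show ?thesis
    by (auto simp: alg_dep_def)
qed

lemma alg_dep_if_trans_degree_1:
  assumes "trans_degree mero_field const_funs K = 1" "mfun x \<in> K" "mfun y \<in> K"
  shows "alg_dep x y"
proof (cases "x = y")
  case False
  then have "enat (card {mfun x, mfun y}) = 2"
    by (simp add: mfun_inject numeral_eq_enat)
  show ?thesis
  proof (rule ccontr)
    assume "\<not> alg_dep x y"
    then have "alg_independent mero_field const_funs {mfun x, mfun y}"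
      using alg_dep_if_not_independent False by blast
    then have "enat (card {mfun x, mfun y}) \<le> trans_degree mero_field const_funs K"
      unfolding trans_degree_def using assms by (intro SUP_upper) auto
    then show False
      using assms(1) \<open>enat _ = 2\<close> by simp
  qed
qed (simp add: alg_dep_refl)

text \<open>A constant a is a root of X - a, which in multiset form has the monomials
  \<open>{#f#}\<close> and \<open>{#}\<close> with coefficients 1 and -a.\<close>

lemma not_independent_const:
  assumes "f \<in> S" "f \<in> const_funs"
  shows "\<not> alg_independent mero_field const_funs S"
proof
  assume *: "alg_independent mero_field const_funs S"
  obtain a where a: "f = mfun (cst a)"
    using assms(2) by (auto simp: const_funs_eq)
  define c where "c = (\<lambda>m :: (complex \<Rightarrow> complex) multiset. if m = {#} then mfun (cst (- a)) else mfun (cst 1))"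
  have "eval_monom mero_field {#f#} = mfun (cst a)" "eval_monom mero_field {#} = mfun 1"
    using eval_monom_mfun[of "{cst a}" "{#f#}"] eval_monom_mfun[of "{}" "{#}"] by (auto simp: a)
  then have "finsum mero_field (\<lambda>m. c m \<otimes>\<^bsub>mero_field\<^esub> eval_monom mero_field m) {{#f#}, {#}} =
      mfun (cst 1 * cst a + cst (- a))"
    by (subst MF.finsum_insert) (auto simp: c_def mfun_ring(2-4) simp del: mfun_cst cst_hom mfun_1)
  also have "\<dots> = \<zero>\<^bsub>mero_field\<^esub>"
    by (simp add: mfun_ring(1) del: mfun_0)
  finally have "\<forall>m\<in>{{#f#}, {#}}. c m = \<zero>\<^bsub>mero_field\<^esub>"
    using * assms(1) unfolding alg_independent_def
    by (elim conjE allE[of _ "{{#f#}, {#}}"] allE[of _ c]) (auto simp: c_def const_funs_def)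
  then show False
    by (auto simp: c_def mero_field_def fun_eq_iff)
qed

lemma nonconst_if_trans_degree_1:
  assumes "trans_degree mero_field const_funs K = 1"
  shows "\<not> K \<subseteq> const_funs"
proof
  assume K: "K \<subseteq> const_funs"
  have "trans_degree mero_field const_funs K \<le> 0"
    unfolding trans_degree_def
  proof (rule SUP_least)
    fix S assume "S \<in> {S. S \<subseteq> K \<and> finite S \<and> alg_independent mero_field const_funs S}"
    then have "S = {}"
      using not_independent_const K by blast
    then show "enat (card S) \<le> 0"
      by (simp add: zero_enat_def)
  qed
  with assms show False
    by simp
qed

section \<open>Periods\<close>

definition ident :: mero where "ident = Mero (\<lambda>z. z)"

definition expo :: "complex \<Rightarrow> mero" where "expo c = Mero (\<lambda>z. exp (c * z))"

lemma mfun_ident [simp]: "mfun ident = (\<lambda>z. z)"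
  unfolding ident_def by (intro mfun_Mero analytic_on_imp_nicely_meromorphic_on analytic_intros)

lemma mfun_expo [simp]: "mfun (expo c) = (\<lambda>z. exp (c * z))"
  unfolding expo_def by (intro mfun_Mero analytic_on_imp_nicely_meromorphic_on analytic_intros)

lemma reg_ident [simp]: "reg ident z" and reg_expo [simp]: "reg (expo c) z"
  by (simp_all add: reg_def) (intro analytic_intros)

lemma D_ident: "D ident = 1"
  by (rule D_eqI[where P = "\<lambda>_. True"]) auto

lemma D_expo: "D (expo c) = cst c * expo c"
  by (rule D_eqI[where P = "\<lambda>_. True"]) (auto intro!: derivative_eq_intros)

lemma reg_power [simp]: "reg x z \<Longrightarrow> reg (x ^ n) z"
  and mfun_power_at [simp]: "reg x z \<Longrightarrow> mfun (x ^ n) z = mfun x z ^ n"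
  by (induction n) auto

lemma expo_power: "expo c ^ n = expo (of_nat n * c)"
  by (rule mero_eqI') (simp add: exp_of_nat_mult[symmetric] mult_ac)

lemma nonconst_ident: "ident \<notin> range cst"
  using D_ident D_cst by (metis imageE zero_neq_one)

lemma expo_nonzero: "expo c \<noteq> 0"
  using mfun_expo[of c] exp_not_eq_zero by (metis mfun_0)

lemma nonconst_expo: "c \<noteq> 0 \<Longrightarrow> expo c \<notin> range cst"
  using D_expo[of c] expo_nonzero[of c] by auto

lemma rational_relation_eqI:
  assumes "frequently (\<lambda>w. mfun x w * poly q (mfun t w) = poly p (mfun t w)) (at z)"
    and "\<And>w. reg t w"
  shows "x * cpoly q t = cpoly p t"
proof (rule mero_eqI[of _ _ z])
  have "frequently (\<lambda>w. mfun x w * poly q (mfun t w) = poly p (mfun t w) \<and> reg x w) (at z)"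
    by (rule frequently_eventually_frequently[OF assms(1) eventually_reg])
  then show "frequently (\<lambda>w. reg (x * cpoly q t) w \<and> reg (cpoly p t) w \<longrightarrow>
      mfun (x * cpoly q t) w = mfun (cpoly p t) w) (at z)"
    by (rule frequently_elim1) (use assms(2) in auto)
qed

text \<open>Condition (2) carried over to the type \<open>mero\<close>. Transcendence degree 1
  enters as algebraic dependence of any two elements; finite generation is supplied separately to
  \<open>common_period\<close>.\<close>

locale differential_function_field = subfield_of K for K :: "mero set" +
  assumes cst_in [simp, intro]: "cst c \<in> K"
    and alg_dep: "x \<in> K \<Longrightarrow> y \<in> K \<Longrightarrow> alg_dep x y"
    and D_in: "x \<in> K \<Longrightarrow> D x \<in> K"
begin

sublocale differential_field_with_constants K D
  by unfold_locales (use D_in D_eq_0_imp_cst in \<open>auto simp: D_mult\<close>)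

lemma cpoly_in: "x \<in> K \<Longrightarrow> cpoly p x \<in> K"
  by (induction p) auto

lemma bipoly_in: "x \<in> K \<Longrightarrow> y \<in> K \<Longrightarrow> bipoly Q x y \<in> K"
  by (induction Q) (auto simp: cpoly_in)

lemma generic_fibre_in:
  assumes "x \<in> K" "x \<notin> range cst"
  obtains B where "finite B" "\<forall>a. a \<notin> B \<longrightarrow> finite (mfun (D x) ` {z. mfun x z = a})"
    "\<forall>z1 z2. mfun x z1 \<notin> B \<longrightarrow> mfun x z2 = mfun x z1 \<longrightarrow> mfun (D x) z2 = mfun (D x) z1 \<longrightarrow>
       aff 1 (z2 - z1) x = x"
proof (rule generic_fibre[OF assms(2)])
  show "alg_dep x (D x)" "alg_dep x (bipoly Q x (D x))" for Q
    by (intro alg_dep D_in bipoly_in assms(1))+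
  fix B
  assume "finite B" "\<And>a. a \<notin> B \<Longrightarrow> finite (mfun (D x) ` {z. mfun x z = a})"
    "\<And>z1 z2. mfun x z1 \<notin> B \<Longrightarrow> mfun x z2 = mfun x z1 \<Longrightarrow> mfun (D x) z2 = mfun (D x) z1 \<Longrightarrow>
       aff 1 (z2 - z1) x = x"
  then show thesis
    by (intro that[of B]) simp_all
qed

text \<open>Each of the finitely many generators has its own multiple of \<open>\<omega>\<close>;
  their product works for all. The functions fixed by a translation form a subfield, so containing
  the constants and the generators it contains \<open>K\<close>.\<close>

lemma common_period:
  assumes H: "finite H" "H \<subseteq> K" "K \<subseteq> mfun -` generate_field mero_field (const_funs \<union> mfun ` H)"
    and x: "x \<in> K" "x \<notin> range cst" "aff 1 \<omega> x = x"
  obtains n :: nat where "n > 0" "\<And>y. y \<in> K \<Longrightarrow> aff 1 (of_nat n * \<omega>) y = y"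
proof -
  have "\<forall>h\<in>H. \<exists>n>0. aff 1 (of_nat (n :: nat) * \<omega>) h = h"
  proof
    fix h assume "h \<in> H"
    then have "h \<in> K"
      using H(2) by blast
    obtain n :: nat where "n > 0" "aff 1 (of_nat n * \<omega>) h = h"
      by (rule period_transfer[OF x(2) alg_dep[OF x(1) \<open>h \<in> K\<close>] x(3)])
    then show "\<exists>n>0. aff 1 (of_nat (n :: nat) * \<omega>) h = h"
      by blast
  qed
  then obtain N :: "mero \<Rightarrow> nat" where N: "\<And>h. h \<in> H \<Longrightarrow> N h > 0" "\<And>h. h \<in> H \<Longrightarrow> aff 1 (of_nat (N h) * \<omega>) h = h"
    by metis
  define n where "n = prod N H"
  have n: "n > 0"
    using N(1) by (simp add: n_def prod_pos)
  let ?P = "{y. aff 1 (of_nat n * \<omega>) y = y}"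
  have "H \<subseteq> ?P"
  proof
    fix h assume h: "h \<in> H"
    then have "n = prod N (H - {h}) * N h"
      using H(1) by (simp add: n_def prod.remove mult.commute)
    then have eq: "of_nat n * \<omega> = of_nat (prod N (H - {h})) * (of_nat (N h) * \<omega>)"
      by simp
    show "h \<in> ?P"
      unfolding mem_Collect_eq eq by (rule aff_of_nat_period[OF N(2)[OF h]])
  qed
  have "subfield_of ?P"
  proof
    fix a b assume a: "a \<in> ?P"
    show "inverse a \<in> ?P"
    proof (cases "a = 0")
      case False
      have "a * aff 1 (of_nat n * \<omega>) (inverse a) = aff 1 (of_nat n * \<omega>) (a * inverse a)"
        using a unfolding aff_hom(2)[OF one_neq_zero] by simp
      also have "\<dots> = 1"
        using False by simp
      finally show ?thesis
        using inverse_unique by fastforce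
    qed (use a in simp)
    assume b: "b \<in> ?P"
    have "aff 1 (of_nat n * \<omega>) (a - b) + b = aff 1 (of_nat n * \<omega>) (a - b + b)"
      using b unfolding aff_hom(1)[OF one_neq_zero] by simp
    also have "\<dots> = a"
      using a by simp
    finally show "a - b \<in> ?P"
      by (simp add: eq_diff_eq)
  qed auto
  moreover have "const_funs \<union> mfun ` H \<subseteq> mfun ` ?P"
    using \<open>H \<subseteq> ?P\<close> by (auto simp: const_funs_eq intro!: image_eqI)
  ultimately have "generate_field mero_field (const_funs \<union> mfun ` H) \<subseteq> mfun ` ?P"
    by (rule generate_field_subset)
  then have "K \<subseteq> ?P"
    using H(3) by (auto simp: mfun_inject)
  with n show thesis
    using that by blast
qed

lemma rational_if_no_periods:
  assumes x: "x \<in> K" "x \<notin> range cst" and no_period: "\<And>\<omega>. aff 1 \<omega> x = x \<Longrightarrow> \<omega> = 0"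
  obtains p q where "q \<noteq> 0" "x * cpoly q ident = cpoly p ident"
proof -
  obtain B where "finite B" "\<forall>a. a \<notin> B \<longrightarrow> finite (mfun (D x) ` {z. mfun x z = a})"
    "\<forall>z1 z2. mfun x z1 \<notin> B \<longrightarrow> mfun x z2 = mfun x z1 \<longrightarrow> mfun (D x) z2 = mfun (D x) z1 \<longrightarrow>
       aff 1 (z2 - z1) x = x"
    by (rule generic_fibre_in[OF x])
  then have B: "finite B" "\<And>a. a \<notin> B \<Longrightarrow> finite (mfun (D x) ` {z. mfun x z = a})"
    "\<And>z1 z2. mfun x z1 \<notin> B \<Longrightarrow> mfun x z2 = mfun x z1 \<Longrightarrow> mfun (D x) z2 = mfun (D x) z1 \<Longrightarrow>
       aff 1 (z2 - z1) x = x"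
    by auto
  have fin: "finite {z. mfun x z = a}" if "a \<notin> B" for a
  proof -
    \<comment> \<open>Points of a generic fibre with equal derivative differ by a period, here 0.
      The derivative takes finitely many values on the fibre, so injectivity bounds the fibre
      itself.\<close>
    have "inj_on (mfun (D x)) {z. mfun x z = a}"
    proof (rule inj_onI)
      fix z1 z2 assume "z1 \<in> {z. mfun x z = a}" "z2 \<in> {z. mfun x z = a}" "mfun (D x) z1 = mfun (D x) z2"
      then have "aff 1 (z2 - z1) x = x"
        using B(3)[of z1 z2] that by auto
      then show "z1 = z2"
        using no_period by fastforce
    qed
    then show ?thesis
      using B(2)[OF that] finite_imageD by blast
  qed
  have "infinite (- B)"
    using B(1) by (simp add: Compl_eq_Diff_UNIV infinite_UNIV_char_0)
  then obtain T where T: "T \<subseteq> - B" "finite T" "card T = 3"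
    using infinite_arbitrarily_large by blast
  then obtain a b c where abc: "T = {a, b, c}" "a \<noteq> b" "a \<noteq> c" "b \<noteq> c"
    by (auto simp: card_3_iff)
  have nice: "mfun x nicely_meromorphic_on - {0}"
    by (rule nicely_meromorphic_on_subset[OF mfun_nicely]) simp
  have fin': "finite {w. w \<noteq> 0 \<and> mfun x w = t}" if "t \<in> {a, b, c}" for t
    using fin[of t] that T abc by (auto intro: finite_subset[rotated])
  obtain p q where pq: "q \<noteq> 0" "\<And>z. eventually (\<lambda>w. mfun x w * poly q w = poly p w) (at z)"
    using rational_if_three_finite_fibres[OF nice abc(2-4) fin'] by blast
  have "x * cpoly q ident = cpoly p ident"
    using pq(2)[of 0] by (intro rational_relation_eqI[of _ _ _ _ 0] eventually_frequently) auto
  with pq(1) show thesis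
    by (rule that)
qed

text \<open>Periodicity makes \<open>x\<close> a function \<open>g\<close> of an exponential. A
  fibre of \<open>g\<close> lifts to points given by principal logarithms; those with equal
  derivative differ by bounded real multiples of \<open>\<omega>\<close>, so infinitely many of them
  would accumulate.\<close>

lemma rational_in_expo_if_periods_on_line:
  assumes x: "x \<in> K" "x \<notin> range cst" and \<omega>: "\<omega> \<noteq> 0" "aff 1 \<omega> x = x"
    and line: "\<And>\<eta>. aff 1 \<eta> x = x \<Longrightarrow> \<exists>t. \<eta> = of_real t * \<omega>"
  obtains p q where "q \<noteq> 0"
    "x * cpoly q (expo (2 * pi * \<i> / \<omega>)) = cpoly p (expo (2 * pi * \<i> / \<omega>))"
proof -
  \<comment> \<open>Adding \<open>\<omega>\<close> to z fixes w = exp (z / d). The principal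
    logarithm is one way back from w to z, and periodicity makes \<open>g\<close> independent of
    that choice.\<close>
  define d where "d = \<omega> / (2 * pi * \<i>)"
  have d: "d \<noteq> 0"
    using \<omega> by (simp add: d_def)
  define g where "g = (\<lambda>w. mfun x (d * Ln w))"
  have g_exp: "mfun x (d * v) = g w" if "exp v = w" for v w
  proof -
    have "w \<noteq> 0"
      using that by auto
    then have "exp v = exp (Ln w)"
      using that by simp
    then obtain n where "v = Ln w + of_int (2 * n) * pi * \<i>"
      by (auto simp: exp_eq)
    then have "d * v = d * Ln w + of_int n * \<omega>"
      by (simp add: d_def field_simps)
    then show ?thesis
      using mfun_of_int_period[OF \<omega>(2)] by (simp add: g_def)
  qed
  have g: "g nicely_meromorphic_on - {0}"
  proof (subst nicely_meromorphic_on_pointwise, intro ballI)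
    fix w0 :: complex assume "w0 \<in> - {0}"
    then have w0: "w0 \<noteq> 0"
      by simp
    \<comment> \<open>\<open>Ln\<close> is discontinuous on the negative axis. Dividing by
      \<open>w0\<close> moves the base point to 1, so \<open>L\<close> is a branch analytic near
      \<open>w0\<close>.\<close>
    define L where "L = (\<lambda>w. d * (Ln (w / w0) + Ln w0))"
    have L_an: "L analytic_on {w0}"
      unfolding L_def using w0 by (intro analytic_intros) auto
    have nz: "eventually (\<lambda>w. w \<noteq> 0) (nhds w0)"
      using w0 by (rule t1_space_nhds)
    have expL: "exp (L w / d) = w" if "w \<noteq> 0" for w
      using that w0 d by (simp add: L_def exp_add)
    have "eventually (\<lambda>w. g w = mfun x (L w)) (nhds w0)"
      using nz
    proof eventually_elim
      case (elim w)
      then show ?case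
        using g_exp[OF expL, of w] d by simp
    qed
    moreover have "(\<lambda>w. mfun x (L w)) nicely_meromorphic_on {w0}"
    proof (rule nicely_meromorphic_on_compose[OF mfun_nicely L_an])
      fix z assume z: "z \<in> {w0}"
      have "eventually (\<lambda>w. w \<noteq> 0 \<and> w \<noteq> w0) (at w0)"
        using nz by (auto simp: eventually_at_filter elim: eventually_mono)
      then show "eventually (\<lambda>w. L w \<noteq> L z) (at z)"
        using z expL w0 by (auto elim!: eventually_mono) metis
    qed simp
    ultimately show "g nicely_meromorphic_on {w0}"
      by (rule nicely_meromorphic_at_cong)
  qed
  obtain B where "finite B" "\<forall>a. a \<notin> B \<longrightarrow> finite (mfun (D x) ` {z. mfun x z = a})"
    "\<forall>z1 z2. mfun x z1 \<notin> B \<longrightarrow> mfun x z2 = mfun x z1 \<longrightarrow> mfun (D x) z2 = mfun (D x) z1 \<longrightarrow>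
       aff 1 (z2 - z1) x = x"
    by (rule generic_fibre_in[OF x])
  then have B: "finite B" "\<And>a. a \<notin> B \<Longrightarrow> finite (mfun (D x) ` {z. mfun x z = a})"
    "\<And>z1 z2. mfun x z1 \<notin> B \<Longrightarrow> mfun x z2 = mfun x z1 \<Longrightarrow> mfun (D x) z2 = mfun (D x) z1 \<Longrightarrow>
       aff 1 (z2 - z1) x = x"
    by auto
  have fin: "finite {w. w \<noteq> 0 \<and> g w = a}" if a: "a \<notin> B" for a
  proof (rule ccontr)
    let ?W = "{w. w \<noteq> 0 \<and> g w = a}"
    assume "infinite ?W"
    moreover have "inj_on (\<lambda>w. d * Ln w) ?W"
      using d by (intro inj_onI) (metis (mono_tags, lifting) exp_Ln mem_Collect_eq mult_cancel_left)
    ultimately have inf: "infinite ((\<lambda>w. d * Ln w) ` ?W)"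
      using finite_imageD by blast
    define Z where "Z = (\<lambda>w. d * Ln w) ` ?W"
    have Z_fib: "Z \<subseteq> {z. mfun x z = a}"
      by (auto simp: Z_def g_def)
    then have "finite (mfun (D x) ` Z)"
      using B(2)[OF a] finite_subset image_mono by metis
    then obtain z1 where z1: "z1 \<in> Z" "infinite {z \<in> Z. mfun (D x) z = mfun (D x) z1}"
      using pigeonhole_infinite[OF inf[folded Z_def]] by blast
    define Y where "Y = {z \<in> Z. mfun (D x) z = mfun (D x) z1}"
    \<comment> \<open>Imaginary parts of principal logarithms lie in an interval of length 2 pi,
      which bounds \<open>t\<close> by 1. The infinite set \<open>Y\<close> then lies in a compact
      segment and accumulates, forcing \<open>x\<close> to be constant.\<close>
    have "Y \<subseteq> (\<lambda>t. z1 + of_real t * \<omega>) ` {-1..1}"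
    proof
      fix z assume z: "z \<in> Y"
      then have "aff 1 (z - z1) x = x"
        using z1 Z_fib B(3)[of z1 z] a by (auto simp: Y_def)
      then obtain t where t: "z - z1 = of_real t * \<omega>"
        using line by blast
      obtain w w1 where w: "z = d * Ln w" "w \<noteq> 0" "z1 = d * Ln w1" "w1 \<noteq> 0"
        using z z1 by (auto simp: Z_def Y_def)
      have "\<omega> * (Ln w - Ln w1) = \<omega> * (of_real t * (2 * pi * \<i>))"
        using t by (simp add: w d_def field_simps)
      then have "Ln w - Ln w1 = of_real t * (2 * pi * \<i>)"
        using \<omega>(1) by simp
      then have "Im (Ln w) - Im (Ln w1) = t * (2 * pi)"
        by (metis Im_complex_of_real Im_i_times Re_complex_of_real minus_complex.simps(2) mult.commute
            mult.left_commute of_real_mult of_real_numeral)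
      then have "\<bar>t * (2 * pi)\<bar> \<le> 2 * pi"
        using mpi_less_Im_Ln[OF w(2)] Im_Ln_le_pi[OF w(2)] mpi_less_Im_Ln[OF w(4)] Im_Ln_le_pi[OF w(4)] by linarith
      then have "\<bar>t\<bar> \<le> 1"
        by (simp add: abs_mult)
      then show "z \<in> (\<lambda>t. z1 + of_real t * \<omega>) ` {-1..1}"
        using t by (intro image_eqI[of _ _ t]) (auto simp: algebra_simps)
    qed
    moreover have "compact ((\<lambda>t::real. z1 + of_real t * \<omega>) ` {-1..1})"
      by (intro compact_continuous_image continuous_intros) auto
    ultimately obtain \<zeta> where "\<zeta> islimpt Y"
      using z1(2) unfolding compact_eq_Bolzano_Weierstrass Y_def by metis
    then have "frequently (\<lambda>w. w \<in> Y) (at \<zeta>)"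
      by (simp add: islimpt_conv_frequently_at)
    then have "frequently (\<lambda>w. mfun x w = a) (at \<zeta>)"
      by (rule frequently_elim1) (use Z_fib in \<open>auto simp: Y_def\<close>)
    then show False
      using frequently_eq_imp_cst x(2) by blast
  qed
  have "infinite (- B)"
    using B(1) by (simp add: Compl_eq_Diff_UNIV infinite_UNIV_char_0)
  then obtain T where T: "T \<subseteq> - B" "finite T" "card T = 3"
    using infinite_arbitrarily_large by blast
  then obtain a b c where abc: "T = {a, b, c}" "a \<noteq> b" "a \<noteq> c" "b \<noteq> c"
    by (auto simp: card_3_iff)
  have fin': "finite {w. w \<noteq> 0 \<and> g w = t}" if "t \<in> {a, b, c}" for t
    using fin that T abc(1) by blast
  obtain p q where pq: "q \<noteq> 0" "\<And>z. eventually (\<lambda>w. g w * poly q w = poly p w) (at z)"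
    using rational_if_three_finite_fibres[OF g abc(2-4) fin'] by blast
  define e where "e = 2 * pi * \<i> / \<omega>"
  have "e * d = 1"
    using \<omega> by (simp add: e_def d_def)
  \<comment> \<open>The relation for \<open>g\<close> is known only on punctured neighbourhoods, so
    the exponential must avoid its value at 0 nearby: a nonzero \<open>e * v\<close> of norm below 1
    is no multiple of 2 pi i.\<close>
  have "filterlim (\<lambda>v. exp (e * v)) (at (exp (e * 0))) (at 0)"
    unfolding filterlim_at
  proof
    show "((\<lambda>v. exp (e * v)) \<longlongrightarrow> exp (e * 0)) (at 0)"
      by (intro tendsto_intros)
    have lim: "((\<lambda>v. norm (e * v)) \<longlongrightarrow> norm (e * 0)) (at 0)"
      by (intro tendsto_intros)
    have "eventually (\<lambda>v. norm (e * v) < 1) (at 0)"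
      using order_tendstoD(2)[OF lim, of 1] by simp
    moreover have "eventually (\<lambda>v::complex. v \<noteq> 0) (at 0)"
      by (simp add: eventually_at_filter)
    ultimately show "eventually (\<lambda>v. exp (e * v) \<in> UNIV \<and> exp (e * v) \<noteq> exp (e * 0)) (at 0)"
    proof eventually_elim
      case (elim v)
      have "e * v \<noteq> 0"
        using elim(2) \<open>e * d = 1\<close> by auto
      moreover have "e * v = 0" if one: "exp (e * v) = 1"
      proof -
        obtain n where n: "Re (e * v) = 0" "Im (e * v) = of_int (2 * n) * pi"
          using one unfolding exp_eq_1 by blast
        have "n = 0"
        proof (rule ccontr)
          assume "n \<noteq> 0"
          then have "1 \<le> \<bar>real_of_int n\<bar>"
            by linarith
          then have "2 * pi * 1 \<le> 2 * pi * \<bar>real_of_int n\<bar>"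
            by (intro mult_left_mono) auto
          moreover have "\<bar>Im (e * v)\<bar> = 2 * pi * \<bar>real_of_int n\<bar>"
            unfolding n(2) by (simp add: abs_mult)
          ultimately have "1 < \<bar>Im (e * v)\<bar>"
            using pi_gt3 by linarith
          then show False
            using abs_Im_le_cmod[of "e * v"] elim(1) by linarith
        qed
        with n show ?thesis
          by (intro complex_eqI) simp_all
      qed
      ultimately show ?case
        by auto
    qed
  qed
  then have "eventually (\<lambda>v. g (exp (e * v)) * poly q (exp (e * v)) = poly p (exp (e * v))) (at 0)"
    using pq(2) by (rule eventually_compose_filterlim[rotated])
  then have "eventually (\<lambda>v. mfun x v * poly q (mfun (expo e) v) = poly p (mfun (expo e) v)) (at 0)"
  proof eventually_elim
    case (elim v)
    have "d * (e * v) = v"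
      using \<open>e * d = 1\<close> by (metis mult.assoc mult.commute mult_1)
    then have "mfun x v = g (exp (e * v))"
      using g_exp[of "e * v"] by metis
    with elim show ?case
      by simp
  qed
  then have "x * cpoly q (expo e) = cpoly p (expo e)"
    by (intro rational_relation_eqI[of _ _ _ _ 0] eventually_frequently) auto
  with pq(1) show thesis
    unfolding e_def by (rule that)
qed

end

section \<open>Generators\<close>

text \<open>Membership of \<open>x\<close> in the field generated by \<open>t\<close> over the
  constants, with the denominator cleared. For non-constant \<open>t\<close>,
  \<open>q \<noteq> 0\<close> already gives \<open>cpoly q t \<noteq> 0\<close>.\<close>

definition rational_in :: "mero \<Rightarrow> mero \<Rightarrow> bool" where
  "rational_in t x \<longleftrightarrow> (\<exists>p q. q \<noteq> 0 \<and> x * cpoly q t = cpoly p t)"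

lemma rational_in_cst: "rational_in t (cst c)"
  unfolding rational_in_def by (intro exI[of _ "[:c:]"] exI[of _ 1]) simp

lemma generate_field_eq_if_rational_in:
  assumes S: "subfield_of S" "range cst \<subseteq> S" and t: "t \<in> S" "t \<notin> range cst"
    and rat: "\<And>x. x \<in> S \<Longrightarrow> rational_in t x"
  shows "mfun ` S = generate_field mero_field (const_funs \<union> {mfun t})" (is "_ = ?G")
proof
  have "subfield ?G mero_field"
    by (intro field.generate_field_is_subfield[OF field_mero_field]) (simp add: const_funs_subset)
  then interpret G: subfield_of "{x. mfun x \<in> ?G}"
    by (rule subfield_of_if_subfield)
  have gens: "cst c \<in> {x. mfun x \<in> ?G}" "t \<in> {x. mfun x \<in> ?G}" for c
    by (auto intro!: generate_field.incl simp: const_funs_def)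
  have cp: "cpoly p t \<in> {x. mfun x \<in> ?G}" for p
  proof (induction p)
    case (pCons a p)
    then show ?case
      unfolding cpoly_pCons by (intro G.add_in G.mult_in gens)
  qed (simp only: cpoly_0 G.zero_in)
  show "mfun ` S \<subseteq> ?G"
  proof
    fix f assume "f \<in> mfun ` S"
    then obtain x where x: "x \<in> S" "f = mfun x"
      by auto
    obtain p q where pq: "q \<noteq> 0" "x * cpoly q t = cpoly p t"
      using rat[OF x(1)] by (auto simp: rational_in_def)
    then have "x = cpoly p t / cpoly q t"
      using cpoly_nonzero[OF t(2), of q] by (simp add: field_simps)
    then have "x \<in> {x. mfun x \<in> ?G}"
      using G.divide_in[OF cp cp] by simp
    then show "f \<in> ?G"
      using x by simp
  qed
  show "?G \<subseteq> mfun ` S"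
    by (rule generate_field_subset[OF S(1)]) (use S(2) t(1) in \<open>auto simp: const_funs_eq simp del: mfun_cst\<close>)
qed

section \<open>Rescaling the variable\<close>

lemma aff_inverse: "c \<noteq> 0 \<Longrightarrow> aff (inverse c) 0 (aff c 0 x) = x" "c \<noteq> 0 \<Longrightarrow> aff c 0 (aff (inverse c) 0 x) = x"
  by (simp_all add: aff_aff)

lemma aff_inject: "c \<noteq> 0 \<Longrightarrow> aff c 0 x = aff c 0 y \<longleftrightarrow> x = y"
  by (metis aff_inverse(1))

lemma aff_nonconst: "c \<noteq> 0 \<Longrightarrow> x \<notin> range cst \<Longrightarrow> aff c 0 x \<notin> range cst"
  by (metis aff_hom(3) aff_inject imageE rangeI)

lemma subfield_of_aff_image:
  assumes "subfield_of S" "c \<noteq> 0"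
  shows "subfield_of (aff c 0 ` S)"
proof
  interpret subfield_of S by fact
  fix a b assume "a \<in> aff c 0 ` S"
  then obtain x where x: "x \<in> S" "a = aff c 0 x"
    by auto
  have "inverse (aff c 0 x) = aff c 0 (inverse x)"
  proof (cases "x = 0")
    case False
    then have "aff c 0 x * aff c 0 (inverse x) = 1"
      using assms(2) by (simp flip: aff_hom(2))
    then show ?thesis
      by (rule inverse_unique)
  qed (use assms(2) in simp)
  then show "inverse a \<in> aff c 0 ` S"
    using x by auto
  assume "b \<in> aff c 0 ` S"
  then obtain y where y: "y \<in> S" "b = aff c 0 y"
    by auto
  show "a * b \<in> aff c 0 ` S"
    using x y assms(2) by (auto simp flip: aff_hom(2))
  have "aff c 0 (x - y) + b = a"
    using x y assms(2) by (simp flip: aff_hom(1))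
  then have "a - b = aff c 0 (x - y)"
    by (simp add: diff_eq_eq)
  then show "a - b \<in> aff c 0 ` S"
    using x y by auto
next
  show "1 \<in> aff c 0 ` S"
    using aff_hom(5)[OF assms(2), of 0] subfield_of.one_in[OF assms(1)] by (metis imageI)
qed

text \<open>The step from (1) to (2). Polynomials in \<open>x\<close> belong to the subfield of
  elements whose derivative stays in \<open>S\<close>, and \<open>y\<close> is algebraic over it by
  its relation with \<open>x\<close>.\<close>

lemma D_in_if_generator:
  assumes S: "subfield_of S" "range cst \<subseteq> S" and dep: "\<And>y. y \<in> S \<Longrightarrow> alg_dep x y"
    and x: "x \<in> S" "x \<notin> range cst" "D x \<in> S" and y: "y \<in> S"
  shows "D y \<in> S"
proof -
  interpret subfield_of S by fact
  interpret differential_subfield S D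
    by unfold_locales
  obtain Q where Q: "Q \<noteq> 0" "bipoly Q x y = 0"
    using dep[OF y] by (auto simp: alg_dep_def)
  have cp: "cpoly p x \<in> {a \<in> S. D a \<in> S}" for p
  proof (induction p)
    case (pCons a p)
    have "cst a \<in> {a \<in> S. D a \<in> S}" "x \<in> {a \<in> S. D a \<in> S}"
      using S(2) x by auto
    with pCons show ?case
      unfolding cpoly_pCons by (intro closed_part.add_in closed_part.mult_in)
  qed (simp only: cpoly_0 closed_part.zero_in)
  then have "algebraic_over {a \<in> S. D a \<in> S} y"
    unfolding algebraic_over_def using Q map_cpoly_nonzero[OF x(2) Q(1)]
    by (intro exI[of _ "map_poly (\<lambda>p. cpoly p x) Q"]) (auto simp: bipoly_def coeff_map_poly)
  then show ?thesis
    using y by (rule D_in_if_algebraic[rotated])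
qed

context differential_function_field
begin

text \<open>Reading \<open>x * cpoly q t = cpoly p t\<close> as an equation for \<open>t\<close>
  gives a polynomial over \<open>K\<close>. If it were zero, \<open>x\<close> would be a quotient of
  constant coefficients.\<close>

lemma algebraic_over_if_rational_in:
  assumes "x \<in> K" "x \<notin> range cst" "rational_in t x"
  shows "algebraic_over K t"
proof -
  obtain p q where pq: "q \<noteq> 0" "x * cpoly q t = cpoly p t"
    using assms(3) by (auto simp: rational_in_def)
  define r where "r = smult x (map_poly cst q) - map_poly cst p"
  have "poly r t = 0"
    using pq(2) by (simp add: r_def cpoly_def)
  moreover have coeff: "coeff r i = x * cst (coeff q i) - cst (coeff p i)" for i
    by (simp add: r_def coeff_map_poly)
  moreover have "r \<noteq> 0"
  proof
    define a b where "a = lead_coeff q" and "b = coeff p (degree q)"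
    assume "r = 0"
    then have "x * cst a = cst b"
      using coeff[of "degree q"] by (simp add: a_def b_def)
    moreover have "cst (b / a) * cst a = cst b"
      using pq(1) by (simp add: a_def flip: cst_hom)
    moreover have "cst a \<noteq> 0"
      using pq(1) by (simp add: a_def)
    ultimately have "x = cst (b / a)"
      by (metis mult_right_cancel)
    then show False
      using assms(2) by blast
  qed
  ultimately show ?thesis
    unfolding algebraic_over_def using assms(1) by (intro exI[of _ r]) auto
qed

text \<open>Sorting the relation for \<open>y\<close> by exponents modulo \<open>n\<close> turns it
  into a relation for \<open>t\<close> over \<open>K\<close> of degree below \<open>n\<close>. By
  \<open>min\<close> it splits into one relation in \<open>t ^ n\<close> per residue class.\<close>

lemma rational_in_power:
  assumes y: "y \<in> K" "rational_in t y" and n: "n > 0" "t ^ n \<in> K"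
    and min: "\<And>q. (\<And>i. coeff q i \<in> K) \<Longrightarrow> poly q t = 0 \<Longrightarrow> degree q < n \<Longrightarrow> q = 0"
  shows "rational_in (t ^ n) y"
proof -
  obtain p q where pq: "q \<noteq> 0" "y * cpoly q t = cpoly p t"
    using y(2) by (auto simp: rational_in_def)
  have section_map: "poly_section n r (map_poly cst p) = map_poly cst (poly_section n r p)" for r p
    using n(1) by (intro poly_eqI) (simp add: coeff_poly_section coeff_map_poly)
  have expand: "cpoly p t = (\<Sum>r<n. cpoly (poly_section n r p) (t ^ n) * t ^ r)" for p
    unfolding cpoly_def poly_eq_sum_sections[OF n(1), of "map_poly cst p"] section_map ..
  define c where "c = (\<lambda>r. y * cpoly (poly_section n r q) (t ^ n) - cpoly (poly_section n r p) (t ^ n))"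
  define R where "R = (\<Sum>r<n. monom (c r) r)"
  have coeff_R: "coeff R i = (if i < n then c i else 0)" for i
    by (simp add: R_def coeff_sum)
  have "poly R t = y * cpoly q t - cpoly p t"
    unfolding expand by (simp add: R_def poly_sum poly_monom c_def sum_distrib_left sum_subtractf algebra_simps)
  moreover have "coeff R i \<in> K" for i
    unfolding coeff_R using y n cpoly_in by (auto simp: c_def)
  moreover have "degree R < n"
    using n(1) by (intro degree_lessI) (auto simp: coeff_R)
  ultimately have "R = 0"
    using pq(2) min by auto
  then have c0: "c r = 0" if "r < n" for r
    using coeff_R[of r] that by simp
  \<comment> \<open>A residue class in which \<open>q\<close> has a nonzero coefficient yields a
    nonzero denominator.\<close>
  obtain i where i: "coeff q i \<noteq> 0"
    using pq(1) by (auto simp: poly_eq_iff)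
  have "coeff (poly_section n (i mod n) q) (i div n) \<noteq> 0"
    using i n(1) by (simp add: coeff_poly_section)
  then have "poly_section n (i mod n) q \<noteq> 0"
    by auto
  then show ?thesis
    unfolding rational_in_def using c0[of "i mod n"] n(1) by (auto simp: c_def)
qed

lemma generated_by_ident:
  assumes x: "x \<in> K" "x \<notin> range cst"
    and no_period: "\<And>y \<omega>. y \<in> K \<Longrightarrow> y \<notin> range cst \<Longrightarrow> aff 1 \<omega> y = y \<Longrightarrow> \<omega> = 0"
  shows "mfun ` K = generate_field mero_field (const_funs \<union> {mfun ident})"
proof -
  have rat: "rational_in ident y" if "y \<in> K" for y
  proof (cases "y \<in> range cst")
    case False
    then show ?thesis
      using rational_if_no_periods[OF that False] no_period[OF that] unfolding rational_in_def by metis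
  qed (auto simp: rational_in_cst)
  have "ident \<in> K"
    by (rule primitive_in[OF D_ident algebraic_over_if_rational_in[OF x rat[OF x(1)]]])
  then show ?thesis
    using rat nonconst_ident by (intro generate_field_eq_if_rational_in subfield_of_axioms) auto
qed

text \<open>The given \<open>\<omega>\<close> may be a multiple of a smaller common period, so
  \<open>expo e\<close> itself need not lie in \<open>K\<close>. The least power that does takes its
  place, which is why \<open>c\<close> is \<open>of_nat n * e\<close>.\<close>

lemma generated_by_expo:
  assumes x: "x \<in> K" "x \<notin> range cst" and \<omega>: "\<omega> \<noteq> 0" "\<And>y. y \<in> K \<Longrightarrow> aff 1 \<omega> y = y"
    and line: "\<And>y \<eta>. y \<in> K \<Longrightarrow> y \<notin> range cst \<Longrightarrow> aff 1 \<eta> y = y \<Longrightarrow> \<exists>t. \<eta> = of_real t * \<omega>"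
  obtains c where "c \<noteq> 0" "expo c \<in> K" "\<And>y. y \<in> K \<Longrightarrow> rational_in (expo c) y"
proof -
  define e where "e = 2 * pi * \<i> / \<omega>"
  have e: "e \<noteq> 0"
    using \<omega>(1) by (simp add: e_def)
  have rat: "rational_in (expo e) y" if y: "y \<in> K" for y
  proof (cases "y \<in> range cst")
    case False
    obtain p q where "q \<noteq> 0" "y * cpoly q (expo e) = cpoly p (expo e)"
      unfolding e_def
      by (rule rational_in_expo_if_periods_on_line[OF y False \<omega>(1) \<omega>(2)[OF y] line[OF y False]])
    then show ?thesis
      by (auto simp: rational_in_def)
  qed (auto simp: rational_in_cst)
  obtain n where n: "n > 0" "expo e ^ n \<in> K"
    "\<And>q. (\<And>i. coeff q i \<in> K) \<Longrightarrow> poly q (expo e) = 0 \<Longrightarrow> degree q < n \<Longrightarrow> q = 0"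
    by (rule exponential_power_in[OF D_expo _ expo_nonzero algebraic_over_if_rational_in[OF x rat[OF x(1)]]]) auto
  show thesis
  proof (rule that[of "of_nat n * e"])
    show "of_nat n * e \<noteq> 0"
      using e n(1) by simp
    show "expo (of_nat n * e) \<in> K"
      using n(2) by (simp add: expo_power)
    show "rational_in (expo (of_nat n * e)) y" if "y \<in> K" for y
      using rational_in_power[OF that rat[OF that] n] by (simp add: expo_power)
  qed
qed

end

section \<open>Linear isomorphisms of the plane and lattices\<close>

lemma linear_times: "Vector_Spaces.linear (*) (*) (\<lambda>z::complex. c * z)"
  by unfold_locales (simp_all add: algebra_simps)

lemma bij_times: "(c::complex) \<noteq> 0 \<Longrightarrow> bij (\<lambda>z. c * z)"
  by (rule bij_betw_byWitness[where f' = "\<lambda>z. z / c"]) auto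

lemma linear_bijE:
  assumes "Vector_Spaces.linear (*) (*) \<Phi>" "bij (\<Phi> :: complex \<Rightarrow> complex)"
  obtains c where "c \<noteq> 0" "\<Phi> = (\<lambda>z. c * z)"
proof
  interpret Vector_Spaces.linear "(*)" "(*)" \<Phi> by fact
  show eq: "\<Phi> = (\<lambda>z. \<Phi> 1 * z)"
  proof
    fix z
    show "\<Phi> z = \<Phi> 1 * z"
      using scale[of z 1] by (simp add: mult.commute)
  qed
  show "\<Phi> 1 \<noteq> 0"
  proof
    assume "\<Phi> 1 = 0"
    then have "\<Phi> 1 = \<Phi> 0"
      by (simp add: zero)
    then show False
      using assms(2) by (metis bij_pointE zero_neq_one)
  qed
qed

lemma pullback_times: "c \<noteq> 0 \<Longrightarrow> pullback (\<lambda>z. c * z) (mfun ` S) = mfun ` aff c 0 ` S"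
  by (auto simp: pullback_def o_def image_iff intro!: exI)

lemma mfun_mem_image: "mfun x \<in> mfun ` S \<longleftrightarrow> x \<in> S"
  by (auto simp: mfun_inject)

lemma closed_by_derivative_mfun_image: "closed_by_derivative (mfun ` S) \<longleftrightarrow> (\<forall>x\<in>S. D x \<in> S)"
  by (simp add: closed_by_derivative_def mfun_mem_image flip: mfun_D)

lemma constant_on_mfun: "mfun x constant_on UNIV \<longleftrightarrow> x \<in> range cst"
proof
  assume "mfun x constant_on UNIV"
  then obtain c where "mfun x = mfun (cst c)"
    by (auto simp: constant_on_def)
  then show "x \<in> range cst"
    by (simp only: mfun_inject) simp
qed (auto simp: constant_on_def)

definition lattice :: "complex \<Rightarrow> complex \<Rightarrow> complex set" where
  "lattice \<omega>1 \<omega>2 = {of_int m * \<omega>1 + of_int n * \<omega>2 | m n. True}"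

lemma rank2_lattice_lattice:
  assumes "\<omega>1 \<noteq> 0" "\<And>t. \<omega>2 \<noteq> of_real t * \<omega>1"
  shows "rank2_lattice (lattice \<omega>1 \<omega>2)"
proof -
  have "\<omega>1 \<noteq> \<omega>2"
    using assms(2)[of 1] by auto
  moreover have "\<omega>2 \<notin> span {\<omega>1}"
    using assms(2) by (auto simp: span_singleton scaleR_conv_of_real)
  then have "independent {\<omega>2, \<omega>1}"
    using assms(1) \<open>\<omega>1 \<noteq> \<omega>2\<close> by (simp add: independent_insert)
  then have "independent {\<omega>1, \<omega>2}"
    by (simp add: insert_commute)
  ultimately show ?thesis
    unfolding rank2_lattice_def lattice_def by blast
qed

lemma elliptic_field_lattice:
  assumes "aff 1 \<omega>1 x = x" "aff 1 \<omega>2 x = x"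
  shows "mfun x \<in> elliptic_field (lattice \<omega>1 \<omega>2)"
proof -
  have "mfun x (z + (of_int m * \<omega>1 + of_int n * \<omega>2)) = mfun x z" for z m n
    using mfun_of_int_period[OF assms(1), of z m] mfun_of_int_period[OF assms(2), of "z + of_int m * \<omega>1" n]
    by (simp add: add.assoc)
  then show ?thesis
    by (auto simp: elliptic_field_def lattice_def)
qed

theorem theorem1:
  fixes K :: "(complex \<Rightarrow> complex) set"
  assumes "subfield K mero_field"
    and "const_funs \<subseteq> K"
    and "fin_gen_field_over mero_field const_funs K"
    and "trans_degree mero_field const_funs K = 1"
  shows
    "((\<exists>f\<in>K. \<not> f constant_on UNIV \<and> mero_deriv f \<in> K) \<longleftrightarrow> closed_by_derivative K) \<and>
     (closed_by_derivative K \<longleftrightarrow>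
       (\<exists>\<Phi> :: complex \<Rightarrow> complex. Vector_Spaces.linear (*) (*) \<Phi> \<and> bij \<Phi> \<and>
          (pullback \<Phi> K = generate_field mero_field (const_funs \<union> {\<lambda>\<zeta>. \<zeta>}) \<or>
           pullback \<Phi> K = generate_field mero_field (const_funs \<union> {\<lambda>\<zeta>. exp \<zeta>}) \<or>
           (\<exists>\<Lambda>. rank2_lattice \<Lambda> \<and> subfield (pullback \<Phi> K) mero_field \<and>
              const_funs \<subseteq> pullback \<Phi> K \<and> pullback \<Phi> K \<subseteq> elliptic_field \<Lambda> \<and>
              closed_by_derivative (pullback \<Phi> K)))))"
    (is "(?one \<longleftrightarrow> ?two) \<and> (?two \<longleftrightarrow> ?three)")
proof -
  define S where "S = {x. mfun x \<in> K}"
  have K: "K = mfun ` S"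
    unfolding S_def by (rule subfield_eq_mfun_image[OF assms(1)])
  have S: "subfield_of S"
    unfolding S_def by (rule subfield_of_if_subfield[OF assms(1)])
  interpret subfield_of S by (rule S)
  have cst: "range cst \<subseteq> S"
    using assms(2) by (auto simp: S_def const_funs_def)
  have dep: "alg_dep x y" if "x \<in> S" "y \<in> S" for x y
    using alg_dep_if_trans_degree_1[OF assms(4)] that by (simp add: S_def)
  obtain H where H: "finite H" "H \<subseteq> S" "K = generate_field mero_field (const_funs \<union> mfun ` H)"
  proof -
    obtain H' where "finite H'" "H' \<subseteq> K" "K = generate_field mero_field (const_funs \<union> H')"
      using assms(3) by (auto simp: fin_gen_field_over_def)
    then show thesis
      using that finite_subset_image[of H' mfun S] K by metis
  qed
  have nonconst: "\<exists>x\<in>S. x \<notin> range cst"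
    using nonconst_if_trans_degree_1[OF assms(4)] by (auto simp: K const_funs_eq simp del: mfun_cst)
  have one: "?one \<longleftrightarrow> (\<exists>x\<in>S. x \<notin> range cst \<and> D x \<in> S)"
    unfolding K by (simp add: constant_on_mfun mfun_mem_image flip: mfun_D)
  have two: "?two \<longleftrightarrow> (\<forall>x\<in>S. D x \<in> S)"
    unfolding K by (rule closed_by_derivative_mfun_image)
  have 12: "?two" if ?one
  proof -
    obtain x where x: "x \<in> S" "x \<notin> range cst" "D x \<in> S"
      using \<open>?one\<close> unfolding one by blast
    have "D y \<in> S" if "y \<in> S" for y
      by (rule D_in_if_generator[OF S cst dep[OF x(1)] x that])
    then show ?two
      unfolding two by blast
  qed
  have 21: "?one" if ?two
    using that nonconst unfolding one two by blast
  have 31: "?one" if ?three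
  proof -
    obtain \<Phi> where lin: "Vector_Spaces.linear (*) (*) \<Phi>" "bij \<Phi>" and
      cases: "pullback \<Phi> K = generate_field mero_field (const_funs \<union> {\<lambda>\<zeta>. \<zeta>}) \<or>
           pullback \<Phi> K = generate_field mero_field (const_funs \<union> {\<lambda>\<zeta>. exp \<zeta>}) \<or>
           closed_by_derivative (pullback \<Phi> K)"
      using \<open>?three\<close> by blast
    obtain c where c: "c \<noteq> 0" "\<Phi> = (\<lambda>z. c * z)"
      using linear_bijE[OF lin] by blast
    define T where "T = aff c 0 ` S"
    have pb: "pullback \<Phi> K = mfun ` T"
      unfolding c(2) K T_def by (rule pullback_times[OF c(1)])
    interpret T: subfield_of T
      unfolding T_def by (rule subfield_of_aff_image[OF S c(1)])
    have mem: "x \<in> T" if "mfun ` T = generate_field mero_field (const_funs \<union> {mfun x})" for x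
    proof -
      have "mfun x \<in> mfun ` T"
        unfolding that by (rule generate_field.incl) simp
      then show ?thesis
        by (simp only: mfun_mem_image)
    qed
    \<comment> \<open>The witnesses are the coordinate, the exponential, and in the elliptic case
      the pullback of any non-constant element.\<close>
    have "\<exists>x\<in>T. x \<notin> range cst \<and> D x \<in> T"
      using cases unfolding pb
    proof (elim disjE)
      assume "mfun ` T = generate_field mero_field (const_funs \<union> {\<lambda>\<zeta>. \<zeta>})"
      then have "ident \<in> T"
        by (intro mem) simp
      then show ?thesis
        using nonconst_ident by (intro bexI[of _ ident]) (auto simp: D_ident)
    next
      assume "mfun ` T = generate_field mero_field (const_funs \<union> {\<lambda>\<zeta>. exp \<zeta>})"
      then have "expo 1 \<in> T"
        by (intro mem) simp
      then show ?thesis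
        using nonconst_expo[of 1] by (intro bexI[of _ "expo 1"]) (auto simp: D_expo)
    next
      assume "closed_by_derivative (mfun ` T)"
      then have "D x \<in> T" if "x \<in> T" for x
        using that by (simp add: closed_by_derivative_mfun_image)
      moreover obtain x where "x \<in> S" "x \<notin> range cst"
        using nonconst by blast
      ultimately show ?thesis
        using aff_nonconst[OF c(1)] by (intro bexI[of _ "aff c 0 x"]) (auto simp: T_def)
    qed
    then obtain x y where x: "x \<in> S" "aff c 0 x \<notin> range cst" "y \<in> S" "D (aff c 0 x) = aff c 0 y"
      by (auto simp: T_def)
    \<comment> \<open>The chain rule contributes the factor \<open>c\<close>, a nonzero constant of
      the field, which is divided out.\<close>
    have "aff c 0 (cst c * D x) = aff c 0 y"
      using x(4) c(1) by (simp add: D_aff)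
    then have "cst c * D x = y"
      using aff_inject[OF c(1)] by blast
    then have "D x = y / cst c"
      using c(1) by (simp add: field_simps)
    then have "D x \<in> S"
      using x(3) cst by (auto intro: divide_in)
    moreover have "x \<notin> range cst"
      using x(2) c(1) by auto
    ultimately show ?one
      unfolding one using x(1) by blast
  qed
  have 23: "?three" if ?two
  proof -
    have D_in: "\<And>x. x \<in> S \<Longrightarrow> D x \<in> S"
      using \<open>?two\<close> unfolding two by blast
    interpret differential_function_field S
      using cst dep D_in by unfold_locales auto
    have pb_id: "pullback (\<lambda>z. 1 * z) K = K"
      by (auto simp: pullback_def o_def)
    \<comment> \<open>Either no non-constant element has a nonzero period, or some element has two
      periods independent over the reals, or nonzero periods exist and those of each non-constant
      element lie on one real line.\<close>
    consider
      (none) "\<And>y \<omega>. y \<in> S \<Longrightarrow> y \<notin> range cst \<Longrightarrow> aff 1 \<omega> y = y \<Longrightarrow> \<omega> = 0"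
    | (two) x \<omega>1 \<omega>2 where "x \<in> S" "x \<notin> range cst" "\<omega>1 \<noteq> 0" "aff 1 \<omega>1 x = x" "aff 1 \<omega>2 x = x"
        "\<And>t. \<omega>2 \<noteq> of_real t * \<omega>1"
    | (one) x \<omega> where "x \<in> S" "x \<notin> range cst" "\<omega> \<noteq> 0" "aff 1 \<omega> x = x"
        "\<And>y \<omega>1 \<omega>2. y \<in> S \<Longrightarrow> y \<notin> range cst \<Longrightarrow> \<omega>1 \<noteq> 0 \<Longrightarrow> aff 1 \<omega>1 y = y \<Longrightarrow> aff 1 \<omega>2 y = y \<Longrightarrow>
           \<exists>t. \<omega>2 = of_real t * \<omega>1"
      by metis
    then show ?three
    proof cases
      case none
      obtain x where "x \<in> S" "x \<notin> range cst"
        using nonconst by blast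
      then have "mfun ` S = generate_field mero_field (const_funs \<union> {mfun ident})"
        using generated_by_ident none by blast
      then show ?thesis
        using linear_times[of 1] bij_times[of 1] pb_id
        by (intro exI[of _ "\<lambda>z. 1 * z"]) (simp add: K)
    next
      case (two x \<omega>1 \<omega>2)
      have H': "S \<subseteq> mfun -` generate_field mero_field (const_funs \<union> mfun ` H)"
        using H(3) K by blast
      \<comment> \<open>Passing to positive integer multiples makes both periods common to the whole
        field and keeps them independent over the reals.\<close>
      obtain n1 :: nat where n1: "n1 > 0" "\<And>y. y \<in> S \<Longrightarrow> aff 1 (of_nat n1 * \<omega>1) y = y"
        using common_period[OF H(1,2) H' two(1,2,4)] by blast
      obtain n2 :: nat where n2: "n2 > 0" "\<And>y. y \<in> S \<Longrightarrow> aff 1 (of_nat n2 * \<omega>2) y = y"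
        using common_period[OF H(1,2) H' two(1,2,5)] by blast
      have "of_nat n2 * \<omega>2 \<noteq> of_real t * (of_nat n1 * \<omega>1)" for t
      proof
        assume "of_nat n2 * \<omega>2 = of_real t * (of_nat n1 * \<omega>1)"
        then have "\<omega>2 = of_real (t * n1 / n2) * \<omega>1"
          using n2(1) by (simp add: field_simps)
        then show False
          using two(6) by blast
      qed
      then have "rank2_lattice (lattice (of_nat n1 * \<omega>1) (of_nat n2 * \<omega>2))"
        using n1(1) two(3) by (intro rank2_lattice_lattice) auto
      moreover have "K \<subseteq> elliptic_field (lattice (of_nat n1 * \<omega>1) (of_nat n2 * \<omega>2))"
        unfolding K using n1(2) n2(2) elliptic_field_lattice by blast
      ultimately have elliptic: "\<exists>\<Lambda>. rank2_lattice \<Lambda> \<and> subfield K mero_field \<and>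
          const_funs \<subseteq> K \<and> K \<subseteq> elliptic_field \<Lambda> \<and> closed_by_derivative K"
        using assms(1,2) \<open>?two\<close> by (intro exI conjI)
      show ?thesis
        by (intro exI[of _ "\<lambda>z. 1 * z"] conjI disjI2)
          (rule linear_times, rule bij_times[OF one_neq_zero], unfold pb_id, rule elliptic)
    next
      case (one x \<omega>)
      have H': "S \<subseteq> mfun -` generate_field mero_field (const_funs \<union> mfun ` H)"
        using H(3) K by blast
      obtain n :: nat where n: "n > 0" "\<And>y. y \<in> S \<Longrightarrow> aff 1 (of_nat n * \<omega>) y = y"
        using common_period[OF H(1,2) H' one(1,2,4)] by blast
      have "of_nat n * \<omega> \<noteq> 0"
        using n(1) one(3) by simp
      then obtain c where c: "c \<noteq> 0" "expo c \<in> S" "\<And>y. y \<in> S \<Longrightarrow> rational_in (expo c) y"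
        using generated_by_expo[OF one(1,2) _ n(2)] one(5) n(2) by metis
      \<comment> \<open>Replacing z by z / c turns \<open>expo c\<close> into the standard
        exponential.\<close>
      define T where "T = aff (inverse c) 0 ` S"
      have ic: "inverse c \<noteq> 0"
        using c(1) by simp
      have aff_expo: "aff (inverse c) 0 (expo c) = expo 1"
        using c(1) ic by (simp add: mfun_inject[symmetric] flip: mult.assoc)
      have "mfun ` T = generate_field mero_field (const_funs \<union> {mfun (expo 1)})"
      proof (rule generate_field_eq_if_rational_in)
        show "subfield_of T"
          unfolding T_def by (rule subfield_of_aff_image[OF S ic])
        show "range cst \<subseteq> T"
          unfolding T_def using aff_hom(3)[OF ic] cst by (metis image_eqI image_subsetI rangeI subsetD)
        show "expo 1 \<in> T"
          unfolding T_def using c(2) aff_expo by (metis image_eqI)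
        show "expo 1 \<notin> range cst"
          by (rule nonconst_expo) simp
        fix y assume "y \<in> T"
        then obtain s where s: "s \<in> S" "y = aff (inverse c) 0 s"
          by (auto simp: T_def)
        obtain p q where pq: "q \<noteq> 0" "s * cpoly q (expo c) = cpoly p (expo c)"
          using c(3)[OF s(1)] by (auto simp: rational_in_def)
        have "y * cpoly q (expo 1) = aff (inverse c) 0 (s * cpoly q (expo c))"
          using ic by (simp add: s(2) aff_cpoly aff_expo)
        also have "\<dots> = cpoly p (expo 1)"
          using ic by (simp add: pq(2) aff_cpoly aff_expo)
        finally show "rational_in (expo 1) y"
          using pq(1) by (auto simp: rational_in_def)
      qed
      moreover have "pullback (\<lambda>z. inverse c * z) K = mfun ` T"
        unfolding K T_def by (rule pullback_times[OF ic])
      ultimately show ?thesis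
        using linear_times[of "inverse c"] bij_times[OF ic]
        by (intro exI[of _ "\<lambda>z. inverse c * z"]) simp
    qed
  qed
  show ?thesis
    using 12 21 31 23 by argo
qed

end
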